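(* Let $(J,\psi^{J}):(\mathcal{C}\times\mathcal{P},S\times E)\to(\mathcal{D},T)$ be a left Hopf 1-cell in $\mathbf{Mnd}(\mathbf{Cat})$ whose functor $J$ is part of a parametric adjunction $J\dashv_{\mathcal{P}}K$. Then there exists a bijection between the following structures. (i) Hopf parametric adjunctions in $\mathbf{Adj}_R(\mathbf{Cat})$ of the form $$\Big(J(\mathcal{C}\times U^{E}),\,[J(\mathcal{C}\times U^{E})]^{H\psi},\,\lambda^{J H\psi}\Big)\dashv_{\mathcal{P}^{E}}\Big(K((U^{E})^{op}\times\mathcal{D}),\,[K((U^{E})^{op}\times\mathcal{D})]^{H^{\sharp}\psi},\,\lambda^{K H^{\sharp}\psi}\Big).$$ (ii) Hopf parametric adjunctions in $\mathbf{Mnd}(\mathbf{Cat})$ of the form $$\big(J(\mathcal{C}\times U^{E}),\,H(\psi^{J})\big)\dashv_{\mathcal{P}^{E}}\big(K((U^{E})^{op}\times\mathcal{D}),\,H^{\sharp}(\psi^{J})\big).$$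
   Context: All categories are small. A category name also denotes its identity functor, juxtaposition denotes composition and whiskering, and $L\dashv R:\mathcal{C}\to\mathcal{X}$ means $L:\mathcal{C}\to\mathcal{X}$ is left adjoint to $R$. For a monad $(\mathcal{C},S,\mu^S,\eta^S)$, $F^S\dashv U^S:\mathcal{C}\to\mathcal{C}^S$ is the free-forgetful Eilenberg–Moore adjunction; objects of $\mathcal{C}^S$ are $(M,k_M)$. The Eilenberg–Moore category of an identity monad is identified with the category itself, so e.g. $(\mathcal{C}\times\mathcal{P}^E)^{S\times\mathcal{P}^E}=\mathcal{C}^S\times\mathcal{P}^E$. Parametric adjunction $J\dashv_{\mathcal{P}}K$: functors $J:\mathcal{C}\times\mathcal{P}\to\mathcal{D}$, $K:\mathcal{P}^{op}\times\mathcal{D}\to\mathcal{C}$ with, for each $P$, an adjunction $J_P=J(-,P)\dashv K_P=K(P,-)$ with unit $\eta^P$, counit $\varepsilon^P$, such that for $p:P\to P'$, $K_{p^{op}}=K_P\varepsilon^{P'}\circ K_PJ_pK_{P'}\circ\eta^PK_{P'}$. It induces $J(\mathcal{C}\times U^E)\dashv_{\mathcal{P}^E}K((U^E)^{op}\times\mathcal{D})$, with adjunction $J_M\dashv K_M$ at $(M,k_M)$. $\mathbf{Adj}_R(\mathbf{Cat})$: 0-cells are adjunctions; a 1-cell $(J,V,\lambda):(L\dashv R:\mathcal{C}\to\mathcal{X})\to(\overline{L}\dashv\overline{R}:\mathcal{D}\to\mathcal{Y})$ consists of functors $J:\mathcal{C}\to\mathcal{D}$, $V:\mathcal{X}\to\mathcal{Y}$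 and $\lambda:\overline{L}J\to VL$ whose mate $\overline{R}V\varepsilon^{LR}\circ\overline{R}\lambda R\circ\eta^{\overline{R}\,\overline{L}}JR:JR\to\overline{R}V$ is invertible; a 2-cell $(J,V,\lambda)\to(J',V',\lambda')$ is a pair $(\alpha:J\to J',\beta:V\to V')$ with $\beta L\circ\lambda=\lambda'\circ\overline{L}\alpha$. The composite $(K,W,\lambda^{KW})(J,V,\lambda^{JV})$ has left mate $W\lambda^{JV}\circ\lambda^{KW}J$. An adjoint object $(J,V,\lambda^{JV})\dashv(K,W,\lambda^{KW})$ is a pair of adjunctions $J\dashv K$, $V\dashv W$ such that the pair of units and the pair of counits are 2-cells. $\mathbf{Mnd}(\mathbf{Cat})$: 0-cells are monads; a 1-cell $(B,\psi):(\mathcal{C},S)\to(\mathcal{D},T)$ is a functor $B:\mathcal{C}\to\mathcal{D}$ with $\psi:TB\to BS$ satisfying $\psi\circ\mu^TB=B\mu^S\circ\psi S\circ T\psi$ and $\psi\circ\eta^TB=B\eta^S$; a 2-cell $(A,\psi^A)\to(B,\psi^B)$ is $\theta:A\to B$ with $\psi^B\circ T\theta=\theta S\circ\psi^A$; composites are $(KJ,K\psi^J\circ\psi^KJ)$. An adjoint object $(J,\psi^J)\dashv(K,\psi^K)$ is an adjunction $J\dashv K$ whose unit and counit are 2-cells. Lifting: for a 1-cell $(B,\psi):(\mathcal{C},S)\to(\mathcal{D},T)$, $B^{\psi}:\mathcal{C}^S\to\mathcal{D}^T$ is $B^{\psi}(M,k_M)=(BM,Bk_M\circ\psi_M)$,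 and $\Psi(\psi):F^TB\to B^{\psi}F^S$ is the transformation with $U^T\Psi(\psi)=\psi$ (the mate of the identity $BU^S=U^TB^\psi$); $(B,B^\psi,\Psi(\psi))$ is a 1-cell $F^S\dashv U^S\to F^T\dashv U^T$. $H(\psi^J):TJ(\mathcal{C}\times U^E)\to J(S\times U^E)$ has component $J(SC,k_M)\circ\psi^J_{(C,M)}$ at $(C,(M,k_M))$; $(J,\psi^J)$ is left Hopf if $H(\psi^J)$ is invertible. For each $(M,k_M)$ put $\psi^{JM}=H(\psi^J)_{(-,(M,k_M))}:TJ_M\to J_MS$ and $\psi^{KM}=K_MT\varepsilon\circ K_M(\psi^{JM})^{-1}K_M\circ\eta SK_M:SK_M\to K_MT$ ($\eta,\varepsilon$ the unit and counit of $J_M\dashv K_M$). $H^{\sharp}(\psi^J):SK((U^E)^{op}\times\mathcal{D})\to K((U^E)^{op}\times T)$ has components $H^\sharp(\psi^J)((M,k_M),D)=\psi^{KM}_D$. The superscripts $H\psi$ and $H^\sharp\psi$ denote lifting along $H(\psi^J)$ and $H^\sharp(\psi^J)$, so $[J(\mathcal{C}\times U^E)]^{H\psi}:\mathcal{C}^S\times\mathcal{P}^E\to\mathcal{D}^T$ and $[K((U^E)^{op}\times\mathcal{D})]^{H^\sharp\psi}:(\mathcal{P}^E)^{op}\times\mathcal{D}^T\to\mathcal{C}^S$; $\lambda^{JH\psi}=\Psi(H(\psi^J))$ and $\lambda^{KH^\sharp\psi}=\Psi(H^\sharp(\psi^J))$. Hopf parametric adjunction in $\mathbf{Adj}_R(\mathbf{Cat})$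 with parameter category $\mathcal{Q}$, $(A,V,\lambda)\dashv_{\mathcal{Q}}(B,W,\lambda')$: 1-cells $(A,V,\lambda):L\times\mathcal{Q}\dashv R\times\mathcal{Q}\to\overline{L}\dashv\overline{R}$ and $(B,W,\lambda'):\mathcal{Q}^{op}\times\overline{L}\dashv\mathcal{Q}^{op}\times\overline{R}\to L\dashv R$ with parametric adjunctions $A\dashv_{\mathcal{Q}}B$, $V\dashv_{\mathcal{Q}}W$ such that for each $Q$ the 1-cells at $Q$ form an adjoint object $(A_Q,V_Q,\lambda_Q)\dashv(B_Q,W_Q,\lambda'_Q)$. Hopf parametric adjunction in $\mathbf{Mnd}(\mathbf{Cat})$, $(A,\psi)\dashv_{\mathcal{Q}}(B,\psi')$: 1-cells $(A,\psi):(\mathcal{C}\times\mathcal{Q},S\times\mathcal{Q})\to(\mathcal{D},T)$ and $(B,\psi'):(\mathcal{Q}^{op}\times\mathcal{D},\mathcal{Q}^{op}\times T)\to(\mathcal{C},S)$ with $A\dashv_{\mathcal{Q}}B$ such that for each $Q$ the 1-cells at $Q$ form an adjoint object $(A_Q,\psi_Q)\dashv(B_Q,\psi'_Q)$. In the statement $\mathcal{Q}=\mathcal{P}^E$. *)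

theory Defs
  imports "HOL-Library.FuncSet"
begin

section \<open>Categories, functors, transformations, adjunctions\<close>

record ('o, 'a) cat =
  Obj :: "'o set"
  Arr :: "'a set"
  Dom :: "'a \<Rightarrow> 'o"
  Cod :: "'a \<Rightarrow> 'o"
  Ide :: "'o \<Rightarrow> 'a"
  Cmp :: "'a \<Rightarrow> 'a \<Rightarrow> 'a"  (infixl "\<cdot>\<index>" 70)

definition Hom :: "('o, 'a) cat \<Rightarrow> 'o \<Rightarrow> 'o \<Rightarrow> 'a set" where
  "Hom C a b = {f \<in> Arr C. Dom C f = a \<and> Cod C f = b}"

locale category =
  fixes C :: "('o, 'a) cat" (structure)
  assumes dom_obj: "f \<in> Arr C \<Longrightarrow> Dom C f \<in> Obj C"
    and cod_obj: "f \<in> Arr C \<Longrightarrow> Cod C f \<in> Obj C"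
    and ide_hom: "a \<in> Obj C \<Longrightarrow> Ide C a \<in> Hom C a a"
    and cmp_hom: "\<lbrakk>f \<in> Hom C a b; g \<in> Hom C b c\<rbrakk> \<Longrightarrow> g \<cdot> f \<in> Hom C a c"
    and ide_right: "f \<in> Hom C a b \<Longrightarrow> f \<cdot> Ide C a = f"
    and ide_left: "f \<in> Hom C a b \<Longrightarrow> Ide C b \<cdot> f = f"
    and cmp_assoc: "\<lbrakk>f \<in> Hom C a b; g \<in> Hom C b c; h \<in> Hom C c d\<rbrakk>
      \<Longrightarrow> (h \<cdot> g) \<cdot> f = h \<cdot> (g \<cdot> f)"

definition inv_arr :: "('o, 'a) cat \<Rightarrow> 'a \<Rightarrow> 'a" where
  "inv_arr C f = (THE g. g \<in> Hom C (Cod C f) (Dom C f)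
     \<and> g \<cdot>\<^bsub>C\<^esub> f = Ide C (Dom C f) \<and> f \<cdot>\<^bsub>C\<^esub> g = Ide C (Cod C f))"

definition op_cat :: "('o, 'a) cat \<Rightarrow> ('o, 'a) cat" where
  "op_cat C = \<lparr>Obj = Obj C, Arr = Arr C, Dom = Cod C, Cod = Dom C, Ide = Ide C,
     Cmp = (\<lambda>g f. f \<cdot>\<^bsub>C\<^esub> g)\<rparr>"

definition prod_cat :: "('o, 'a) cat \<Rightarrow> ('p, 'b) cat \<Rightarrow> ('o \<times> 'p, 'a \<times> 'b) cat"
    (infixr "\<times>\<^sub>C" 80) where
  "C \<times>\<^sub>C D = \<lparr>Obj = Obj C \<times> Obj D, Arr = Arr C \<times> Arr D,
     Dom = map_prod (Dom C) (Dom D), Cod = map_prod (Cod C) (Cod D),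
     Ide = map_prod (Ide C) (Ide D),
     Cmp = (\<lambda>(g, g') (f, f'). (g \<cdot>\<^bsub>C\<^esub> f, g' \<cdot>\<^bsub>D\<^esub> f'))\<rparr>"

text \<open>A functor is recorded by its actions only; source and target categories are arguments of
  the predicate \<open>cat_functor\<close>. In particular the opposite functor \<open>F\<^sup>o\<^sup>p\<close> is given by the same
  record as \<open>F\<close>.\<close>

record ('o, 'a, 'p, 'b) ftr =
  omap :: "'o \<Rightarrow> 'p"
  amap :: "'a \<Rightarrow> 'b"

definition id_ftr :: "('o, 'a, 'o, 'a) ftr" where
  "id_ftr = \<lparr>omap = (\<lambda>x. x), amap = (\<lambda>f. f)\<rparr>"

definition comp_ftr ::
    "('p, 'b, 'q, 'c) ftr \<Rightarrow> ('o, 'a, 'p, 'b) ftr \<Rightarrow> ('o, 'a, 'q, 'c) ftr"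
    (infixr "\<circ>\<^sub>F" 75) where
  "G \<circ>\<^sub>F F = \<lparr>omap = omap G \<circ> omap F, amap = amap G \<circ> amap F\<rparr>"

definition prod_ftr ::
    "('o, 'a, 'p, 'b) ftr \<Rightarrow> ('o', 'a', 'p', 'b') ftr
      \<Rightarrow> ('o \<times> 'o', 'a \<times> 'a', 'p \<times> 'p', 'b \<times> 'b') ftr"
    (infixr "\<times>\<^sub>F" 80) where
  "F \<times>\<^sub>F G = \<lparr>omap = map_prod (omap F) (omap G), amap = map_prod (amap F) (amap G)\<rparr>"

locale cat_functor = dom_cat: category C + cod_cat: category D
  for C :: "('o, 'a) cat" and D :: "('p, 'b) cat" +
  fixes F :: "('o, 'a, 'p, 'b) ftr"
  assumes omap_obj: "a \<in> Obj C \<Longrightarrow> omap F a \<in> Obj D"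
    and amap_hom: "f \<in> Hom C a b \<Longrightarrow> amap F f \<in> Hom D (omap F a) (omap F b)"
    and amap_ide: "a \<in> Obj C \<Longrightarrow> amap F (Ide C a) = Ide D (omap F a)"
    and amap_cmp: "\<lbrakk>f \<in> Hom C a b; g \<in> Hom C b c\<rbrakk>
      \<Longrightarrow> amap F (g \<cdot>\<^bsub>C\<^esub> f) = amap F g \<cdot>\<^bsub>D\<^esub> amap F f"

locale nat_trans = dom_ftr: cat_functor C D F + cod_ftr: cat_functor C D G
  for C :: "('o, 'a) cat" and D :: "('p, 'b) cat" and F G +
  fixes \<tau> :: "'o \<Rightarrow> 'b"
  assumes component: "a \<in> Obj C \<Longrightarrow> \<tau> a \<in> Hom D (omap F a) (omap G a)"
    and naturality: "f \<in> Hom C a b \<Longrightarrow> amap G f \<cdot>\<^bsub>D\<^esub> \<tau> a = \<tau> b \<cdot>\<^bsub>D\<^esub> amap F f"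

definition nat_iso where
  "nat_iso C D F G \<tau> \<longleftrightarrow> nat_trans C D F G \<tau> \<and>
     (\<exists>\<sigma>. nat_trans C D G F \<sigma> \<and>
        (\<forall>a \<in> Obj C. \<sigma> a \<cdot>\<^bsub>D\<^esub> \<tau> a = Ide D (omap F a) \<and> \<tau> a \<cdot>\<^bsub>D\<^esub> \<sigma> a = Ide D (omap G a)))"

text \<open>\<open>L : C \<rightarrow> X\<close> is left adjoint to \<open>R : X \<rightarrow> C\<close>.\<close>

locale adjunction =
    unit: nat_trans C C id_ftr "R \<circ>\<^sub>F L" \<eta> + counit: nat_trans X X "L \<circ>\<^sub>F R" id_ftr \<epsilon> +
    left: cat_functor C X L + right: cat_functor X C R
  for C :: "('o, 'a) cat" and X :: "('x, 'b) cat" and L R \<eta> \<epsilon> +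
  assumes triangle_left: "c \<in> Obj C \<Longrightarrow> \<epsilon> (omap L c) \<cdot>\<^bsub>X\<^esub> amap L (\<eta> c) = Ide X (omap L c)"
    and triangle_right: "x \<in> Obj X \<Longrightarrow> amap R (\<epsilon> x) \<cdot>\<^bsub>C\<^esub> \<eta> (omap R x) = Ide C (omap R x)"


section \<open>Parametric adjunctions\<close>

definition fix_right ::
    "('q, 'r) cat \<Rightarrow> ('o \<times> 'q, 'a \<times> 'r, 'p, 'b) ftr \<Rightarrow> 'q \<Rightarrow> ('o, 'a, 'p, 'b) ftr" where
  "fix_right Q F q = \<lparr>omap = (\<lambda>c. omap F (c, q)), amap = (\<lambda>f. amap F (f, Ide Q q))\<rparr>"

definition fix_left ::
    "('q, 'r) cat \<Rightarrow> ('q \<times> 'o, 'r \<times> 'a, 'p, 'b) ftr \<Rightarrow> 'q \<Rightarrow> ('o, 'a, 'p, 'b) ftr" where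
  "fix_left Q F q = \<lparr>omap = (\<lambda>c. omap F (q, c)), amap = (\<lambda>f. amap F (Ide Q q, f))\<rparr>"

text \<open>In \<open>param\<close>, the arrow \<open>p : P \<rightarrow> P'\<close> is regarded as an arrow \<open>P' \<rightarrow> P\<close> of the opposite category
  on the left-hand side.\<close>

locale param_adjunction =
    category Q + left: cat_functor "C \<times>\<^sub>C Q" D J + right: cat_functor "op_cat Q \<times>\<^sub>C D" C K
  for C :: "('o, 'a) cat" and Q :: "('q, 'r) cat" and D :: "('p, 'b) cat"
    and J :: "('o \<times> 'q, 'a \<times> 'r, 'p, 'b) ftr" and K :: "('q \<times> 'p, 'r \<times> 'b, 'o, 'a) ftr"
    and \<eta> :: "'q \<Rightarrow> 'o \<Rightarrow> 'a" and \<epsilon> :: "'q \<Rightarrow> 'p \<Rightarrow> 'b" +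
  assumes adj_at: "q \<in> Obj Q \<Longrightarrow> adjunction C D (fix_right Q J q) (fix_left Q K q) (\<eta> q) (\<epsilon> q)"
    and param: "\<lbrakk>p \<in> Hom Q q q'; d \<in> Obj D\<rbrakk> \<Longrightarrow>
      amap K (p, Ide D d) =
        amap (fix_left Q K q) (\<epsilon> q' d)
        \<cdot>\<^bsub>C\<^esub> (amap (fix_left Q K q) (amap J (Ide C (omap K (q', d)), p))
        \<cdot>\<^bsub>C\<^esub> \<eta> q (omap K (q', d)))"

text \<open>Families of components are normalised outside the objects they are indexed by, so that
  counting such families is counting parametric adjunctions.\<close>

definition component_families :: "('q, 'r) cat \<Rightarrow> ('o, 'a) cat \<Rightarrow> ('q \<Rightarrow> 'o \<Rightarrow> 'a) set" where
  "component_families Q C =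
     {\<theta> \<in> extensional (Obj Q). \<forall>q \<in> Obj Q. \<theta> q \<in> extensional (Obj C)}"

definition param_adjunctions where
  "param_adjunctions C Q D J K =
     {(\<eta>, \<epsilon>). \<eta> \<in> component_families Q C \<and> \<epsilon> \<in> component_families Q D
        \<and> param_adjunction C Q D J K \<eta> \<epsilon>}"


section \<open>The 2-category of adjunctions\<close>

text \<open>A 0-cell is an adjunction \<open>aleft \<stileturn> aright : adom \<rightarrow> acod\<close>.\<close>

record ('o, 'a, 'x, 'b) adj =
  adom :: "('o, 'a) cat"
  acod :: "('x, 'b) cat"
  aleft :: "('o, 'a, 'x, 'b) ftr"
  aright :: "('x, 'b, 'o, 'a) ftr"
  aunit :: "'o \<Rightarrow> 'a"
  acounit :: "'x \<Rightarrow> 'b"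

definition adj_0cell :: "('o, 'a, 'x, 'b) adj \<Rightarrow> bool" where
  "adj_0cell A \<longleftrightarrow>
     adjunction (adom A) (acod A) (aleft A) (aright A) (aunit A) (acounit A)"

definition id_adj :: "('q, 'r) cat \<Rightarrow> ('q, 'r, 'q, 'r) adj" where
  "id_adj Q = \<lparr>adom = Q, acod = Q, aleft = id_ftr, aright = id_ftr, aunit = Ide Q, acounit = Ide Q\<rparr>"

definition prod_adj ::
    "('o, 'a, 'x, 'b) adj \<Rightarrow> ('o', 'a', 'x', 'b') adj
      \<Rightarrow> ('o \<times> 'o', 'a \<times> 'a', 'x \<times> 'x', 'b \<times> 'b') adj" (infixr "\<times>\<^sub>A" 80) where
  "A \<times>\<^sub>A B = \<lparr>adom = adom A \<times>\<^sub>C adom B, acod = acod A \<times>\<^sub>C acod B,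
     aleft = aleft A \<times>\<^sub>F aleft B, aright = aright A \<times>\<^sub>F aright B,
     aunit = map_prod (aunit A) (aunit B), acounit = map_prod (acounit A) (acounit B)\<rparr>"

type_synonym ('o, 'a, 'x, 'b, 'o', 'a', 'x', 'b') adj_cell =
  "('o, 'a, 'o', 'a') ftr \<times> ('x, 'b, 'x', 'b') ftr \<times> ('o \<Rightarrow> 'b')"

fun adj_mate ::
    "('o, 'a, 'x, 'b) adj \<Rightarrow> ('o', 'a', 'x', 'b') adj
      \<Rightarrow> ('o, 'a, 'x, 'b, 'o', 'a', 'x', 'b') adj_cell \<Rightarrow> 'x \<Rightarrow> 'a'" where
  "adj_mate A B (J, V, \<Lambda>) x =
     amap (aright B) (amap V (acounit A x))
     \<cdot>\<^bsub>adom B\<^esub> (amap (aright B) (\<Lambda> (omap (aright A) x))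
     \<cdot>\<^bsub>adom B\<^esub> aunit B (omap J (omap (aright A) x)))"

fun adjR_1cell ::
    "('o, 'a, 'x, 'b) adj \<Rightarrow> ('o', 'a', 'x', 'b') adj
      \<Rightarrow> ('o, 'a, 'x, 'b, 'o', 'a', 'x', 'b') adj_cell \<Rightarrow> bool" where
  "adjR_1cell A B (J, V, \<Lambda>) \<longleftrightarrow>
     adj_0cell A \<and> adj_0cell B
     \<and> cat_functor (adom A) (adom B) J \<and> cat_functor (acod A) (acod B) V
     \<and> nat_trans (adom A) (acod B) (aleft B \<circ>\<^sub>F J) (V \<circ>\<^sub>F aleft A) \<Lambda>
     \<and> nat_iso (acod A) (adom B) (J \<circ>\<^sub>F aright A) (aright B \<circ>\<^sub>F V) (adj_mate A B (J, V, \<Lambda>))"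

definition adjR_id ::
    "('o, 'a, 'x, 'b) adj \<Rightarrow> ('o, 'a, 'x, 'b, 'o, 'a, 'x, 'b) adj_cell" where
  "adjR_id A = (id_ftr, id_ftr, \<lambda>c. Ide (acod A) (omap (aleft A) c))"

fun adjR_comp ::
    "('o'', 'a'', 'x'', 'b'') adj
      \<Rightarrow> ('o', 'a', 'x', 'b', 'o'', 'a'', 'x'', 'b'') adj_cell
      \<Rightarrow> ('o, 'a, 'x, 'b, 'o', 'a', 'x', 'b') adj_cell
      \<Rightarrow> ('o, 'a, 'x, 'b, 'o'', 'a'', 'x'', 'b'') adj_cell" where
  "adjR_comp B (K, W, \<Lambda>K) (J, V, \<Lambda>J) =
     (K \<circ>\<^sub>F J, W \<circ>\<^sub>F V, \<lambda>c. amap W (\<Lambda>J c) \<cdot>\<^bsub>acod B\<^esub> \<Lambda>K (omap J c))"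

fun adjR_2cell ::
    "('o, 'a, 'x, 'b) adj \<Rightarrow> ('o', 'a', 'x', 'b') adj
      \<Rightarrow> ('o, 'a, 'x, 'b, 'o', 'a', 'x', 'b') adj_cell
      \<Rightarrow> ('o, 'a, 'x, 'b, 'o', 'a', 'x', 'b') adj_cell
      \<Rightarrow> ('o \<Rightarrow> 'a') \<Rightarrow> ('x \<Rightarrow> 'b') \<Rightarrow> bool" where
  "adjR_2cell A B (J, V, \<Lambda>) (J', V', \<Lambda>') \<alpha> \<beta> \<longleftrightarrow>
     adjR_1cell A B (J, V, \<Lambda>) \<and> adjR_1cell A B (J', V', \<Lambda>')
     \<and> nat_trans (adom A) (adom B) J J' \<alpha> \<and> nat_trans (acod A) (acod B) V V' \<beta>
     \<and> (\<forall>c \<in> Obj (adom A).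
          \<beta> (omap (aleft A) c) \<cdot>\<^bsub>acod B\<^esub> \<Lambda> c = \<Lambda>' c \<cdot>\<^bsub>acod B\<^esub> amap (aleft B) (\<alpha> c))"

fun adjR_adjoint_object where
  "adjR_adjoint_object A B (J, V, \<Lambda>J) (K, W, \<Lambda>K) (\<eta>, \<epsilon>) (\<eta>', \<epsilon>') \<longleftrightarrow>
     adjR_1cell A B (J, V, \<Lambda>J) \<and> adjR_1cell B A (K, W, \<Lambda>K)
     \<and> adjunction (adom A) (adom B) J K \<eta> \<epsilon> \<and> adjunction (acod A) (acod B) V W \<eta>' \<epsilon>'
     \<and> adjR_2cell A A (adjR_id A) (adjR_comp A (K, W, \<Lambda>K) (J, V, \<Lambda>J)) \<eta> \<eta>'
     \<and> adjR_2cell B B (adjR_comp B (J, V, \<Lambda>J) (K, W, \<Lambda>K)) (adjR_id B) \<epsilon> \<epsilon>'"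

text \<open>Hopf parametric adjunctions \<open>(A, V, \<Lambda>A) \<stileturn>\<^sub>Q (B, W, \<Lambda>B)\<close> on given 1-cells: the data are the units
  and counits of \<open>A \<stileturn>\<^sub>Q B\<close> and of \<open>V \<stileturn>\<^sub>Q W\<close>.\<close>

fun hopf_param_adjunctions_AdjR where
  "hopf_param_adjunctions_AdjR X Y Q (A, V, \<Lambda>A) (B, W, \<Lambda>B) =
     {((\<eta>, \<epsilon>), (\<eta>', \<epsilon>')).
        adjR_1cell (X \<times>\<^sub>A id_adj Q) Y (A, V, \<Lambda>A)
        \<and> adjR_1cell (id_adj (op_cat Q) \<times>\<^sub>A Y) X (B, W, \<Lambda>B)
        \<and> (\<eta>, \<epsilon>) \<in> param_adjunctions (adom X) Q (adom Y) A B
        \<and> (\<eta>', \<epsilon>') \<in> param_adjunctions (acod X) Q (acod Y) V W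
        \<and> (\<forall>q \<in> Obj Q. adjR_adjoint_object X Y
             (fix_right Q A q, fix_right Q V q, \<lambda>c. \<Lambda>A (c, q))
             (fix_left Q B q, fix_left Q W q, \<lambda>d. \<Lambda>B (q, d))
             (\<eta> q, \<epsilon> q) (\<eta>' q, \<epsilon>' q))}"


section \<open>The 2-category of monads\<close>

record ('o, 'a) mnd =
  base :: "('o, 'a) cat"
  endo :: "('o, 'a, 'o, 'a) ftr"
  mult :: "'o \<Rightarrow> 'a"
  unit :: "'o \<Rightarrow> 'a"

definition is_monad :: "('o, 'a) mnd \<Rightarrow> bool" where
  "is_monad S \<longleftrightarrow>
     cat_functor (base S) (base S) (endo S)
     \<and> nat_trans (base S) (base S) (endo S \<circ>\<^sub>F endo S) (endo S) (mult S)
     \<and> nat_trans (base S) (base S) id_ftr (endo S) (unit S)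
     \<and> (\<forall>c \<in> Obj (base S).
          mult S c \<cdot>\<^bsub>base S\<^esub> mult S (omap (endo S) c)
            = mult S c \<cdot>\<^bsub>base S\<^esub> amap (endo S) (mult S c)
          \<and> mult S c \<cdot>\<^bsub>base S\<^esub> unit S (omap (endo S) c) = Ide (base S) (omap (endo S) c)
          \<and> mult S c \<cdot>\<^bsub>base S\<^esub> amap (endo S) (unit S c) = Ide (base S) (omap (endo S) c))"

definition id_mnd :: "('q, 'r) cat \<Rightarrow> ('q, 'r) mnd" where
  "id_mnd Q = \<lparr>base = Q, endo = id_ftr, mult = Ide Q, unit = Ide Q\<rparr>"

definition prod_mnd :: "('o, 'a) mnd \<Rightarrow> ('p, 'b) mnd \<Rightarrow> ('o \<times> 'p, 'a \<times> 'b) mnd"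
    (infixr "\<times>\<^sub>M" 80) where
  "S \<times>\<^sub>M E = \<lparr>base = base S \<times>\<^sub>C base E, endo = endo S \<times>\<^sub>F endo E,
     mult = map_prod (mult S) (mult E), unit = map_prod (unit S) (unit E)\<rparr>"

type_synonym ('o, 'a, 'p, 'b) mnd_cell = "('o, 'a, 'p, 'b) ftr \<times> ('o \<Rightarrow> 'b)"

fun mnd_1cell ::
    "('o, 'a) mnd \<Rightarrow> ('p, 'b) mnd \<Rightarrow> ('o, 'a, 'p, 'b) mnd_cell \<Rightarrow> bool" where
  "mnd_1cell S T (B, \<psi>) \<longleftrightarrow>
     is_monad S \<and> is_monad T \<and> cat_functor (base S) (base T) B
     \<and> nat_trans (base S) (base T) (endo T \<circ>\<^sub>F B) (B \<circ>\<^sub>F endo S) \<psi>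
     \<and> (\<forall>c \<in> Obj (base S).
          \<psi> c \<cdot>\<^bsub>base T\<^esub> mult T (omap B c)
            = amap B (mult S c) \<cdot>\<^bsub>base T\<^esub> (\<psi> (omap (endo S) c) \<cdot>\<^bsub>base T\<^esub> amap (endo T) (\<psi> c))
          \<and> \<psi> c \<cdot>\<^bsub>base T\<^esub> unit T (omap B c) = amap B (unit S c))"

definition mnd_id :: "('o, 'a) mnd \<Rightarrow> ('o, 'a, 'o, 'a) mnd_cell" where
  "mnd_id S = (id_ftr, \<lambda>c. Ide (base S) (omap (endo S) c))"

fun mnd_comp ::
    "('q, 'c) mnd \<Rightarrow> ('p, 'b, 'q, 'c) mnd_cell \<Rightarrow> ('o, 'a, 'p, 'b) mnd_cell
      \<Rightarrow> ('o, 'a, 'q, 'c) mnd_cell" where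
  "mnd_comp U (K, \<psi>K) (J, \<psi>J) = (K \<circ>\<^sub>F J, \<lambda>c. amap K (\<psi>J c) \<cdot>\<^bsub>base U\<^esub> \<psi>K (omap J c))"

fun mnd_2cell ::
    "('o, 'a) mnd \<Rightarrow> ('p, 'b) mnd \<Rightarrow> ('o, 'a, 'p, 'b) mnd_cell \<Rightarrow> ('o, 'a, 'p, 'b) mnd_cell
      \<Rightarrow> ('o \<Rightarrow> 'b) \<Rightarrow> bool" where
  "mnd_2cell S T (A, \<psi>A) (B, \<psi>B) \<theta> \<longleftrightarrow>
     mnd_1cell S T (A, \<psi>A) \<and> mnd_1cell S T (B, \<psi>B) \<and> nat_trans (base S) (base T) A B \<theta>
     \<and> (\<forall>c \<in> Obj (base S).
          \<psi>B c \<cdot>\<^bsub>base T\<^esub> amap (endo T) (\<theta> c) = \<theta> (omap (endo S) c) \<cdot>\<^bsub>base T\<^esub> \<psi>A c)"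

fun mnd_adjoint_object where
  "mnd_adjoint_object S T (J, \<psi>J) (K, \<psi>K) (\<eta>, \<epsilon>) \<longleftrightarrow>
     mnd_1cell S T (J, \<psi>J) \<and> mnd_1cell T S (K, \<psi>K)
     \<and> adjunction (base S) (base T) J K \<eta> \<epsilon>
     \<and> mnd_2cell S S (mnd_id S) (mnd_comp S (K, \<psi>K) (J, \<psi>J)) \<eta>
     \<and> mnd_2cell T T (mnd_comp T (J, \<psi>J) (K, \<psi>K)) (mnd_id T) \<epsilon>"

fun hopf_param_adjunctions_Mnd where
  "hopf_param_adjunctions_Mnd S T Q (A, \<psi>A) (B, \<psi>B) =
     {(\<eta>, \<epsilon>).
        mnd_1cell (S \<times>\<^sub>M id_mnd Q) T (A, \<psi>A)
        \<and> mnd_1cell (id_mnd (op_cat Q) \<times>\<^sub>M T) S (B, \<psi>B)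
        \<and> (\<eta>, \<epsilon>) \<in> param_adjunctions (base S) Q (base T) A B
        \<and> (\<forall>q \<in> Obj Q. mnd_adjoint_object S T
             (fix_right Q A q, \<lambda>c. \<psi>A (c, q)) (fix_left Q B q, \<lambda>d. \<psi>B (q, d)) (\<eta> q, \<epsilon> q))}"


section \<open>Eilenberg--Moore categories and liftings\<close>

text \<open>An object is a pair \<open>(M, k)\<close>; an arrow is its underlying arrow together with its source and
  target algebras.\<close>

type_synonym ('o, 'a) em_obj = "'o \<times> 'a"
type_synonym ('o, 'a) em_arr = "('o, 'a) em_obj \<times> 'a \<times> ('o, 'a) em_obj"

definition algebras :: "('o, 'a) mnd \<Rightarrow> ('o, 'a) em_obj set" where
  "algebras S = {(m, k). m \<in> Obj (base S) \<and> k \<in> Hom (base S) (omap (endo S) m) m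
     \<and> k \<cdot>\<^bsub>base S\<^esub> mult S m = k \<cdot>\<^bsub>base S\<^esub> amap (endo S) k
     \<and> k \<cdot>\<^bsub>base S\<^esub> unit S m = Ide (base S) m}"

definition EM :: "('o, 'a) mnd \<Rightarrow> (('o, 'a) em_obj, ('o, 'a) em_arr) cat" where
  "EM S = \<lparr>Obj = algebras S,
     Arr = {(x, f, y). x \<in> algebras S \<and> y \<in> algebras S \<and> f \<in> Hom (base S) (fst x) (fst y)
              \<and> f \<cdot>\<^bsub>base S\<^esub> snd x = snd y \<cdot>\<^bsub>base S\<^esub> amap (endo S) f},
     Dom = (\<lambda>(x, f, y). x), Cod = (\<lambda>(x, f, y). y),
     Ide = (\<lambda>x. (x, Ide (base S) (fst x), x)),
     Cmp = (\<lambda>(y', g, z) (x, f, y). (x, g \<cdot>\<^bsub>base S\<^esub> f, z))\<rparr>"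

definition EM_free :: "('o, 'a) mnd \<Rightarrow> ('o, 'a, ('o, 'a) em_obj, ('o, 'a) em_arr) ftr" where
  "EM_free S =
     (let F = (\<lambda>c. (omap (endo S) c, mult S c))
      in \<lparr>omap = F,
          amap = (\<lambda>f. (F (Dom (base S) f), amap (endo S) f, F (Cod (base S) f)))\<rparr>)"

definition EM_forget :: "(('o, 'a) em_obj, ('o, 'a) em_arr, 'o, 'a) ftr" where
  "EM_forget = \<lparr>omap = fst, amap = (\<lambda>(x, f, y). f)\<rparr>"

definition EM_adj :: "('o, 'a) mnd \<Rightarrow> ('o, 'a, ('o, 'a) em_obj, ('o, 'a) em_arr) adj" where
  "EM_adj S = \<lparr>adom = base S, acod = EM S, aleft = EM_free S, aright = EM_forget,
     aunit = unit S,
     acounit = (\<lambda>(m, k). (omap (EM_free S) m, k, (m, k)))\<rparr>"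

text \<open>The lifting \<open>B\<^sup>\<psi>\<close> of \<open>(B, \<psi>) : (C, S) \<rightarrow> (D, T)\<close> and the transformation
  \<open>\<Psi>(\<psi>) : F\<^sup>T B \<rightarrow> B\<^sup>\<psi> F\<^sup>S\<close> with underlying transformation \<open>\<psi>\<close>.\<close>

fun lift_ftr ::
    "('p, 'b) mnd \<Rightarrow> ('o, 'a, 'p, 'b) mnd_cell
      \<Rightarrow> (('o, 'a) em_obj, ('o, 'a) em_arr, ('p, 'b) em_obj, ('p, 'b) em_arr) ftr" where
  "lift_ftr T (B, \<psi>) =
     (let F = (\<lambda>(m, k). (omap B m, amap B k \<cdot>\<^bsub>base T\<^esub> \<psi> m))
      in \<lparr>omap = F, amap = (\<lambda>(x, f, y). (F x, amap B f, F y))\<rparr>)"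

fun lift_trans ::
    "('o, 'a) mnd \<Rightarrow> ('p, 'b) mnd \<Rightarrow> ('o, 'a, 'p, 'b) mnd_cell \<Rightarrow> 'o \<Rightarrow> ('p, 'b) em_arr" where
  "lift_trans S T (B, \<psi>) c =
     (omap (EM_free T) (omap B c), \<psi> c, omap (lift_ftr T (B, \<psi>)) (omap (EM_free S) c))"

text \<open>The canonical isomorphisms \<open>Q \<cong> Q\<^sup>Q\<close> and \<open>C\<^sup>S \<times> D\<^sup>T \<cong> (C \<times> D)\<^bsup>S\<times>T\<^esup>\<close>, along which these categories
  are identified.\<close>

definition EM_triv :: "('q, 'r) cat \<Rightarrow> ('q, 'r, ('q, 'r) em_obj, ('q, 'r) em_arr) ftr" where
  "EM_triv Q = \<lparr>omap = (\<lambda>q. (q, Ide Q q)),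
     amap = (\<lambda>r. ((Dom Q r, Ide Q (Dom Q r)), r, (Cod Q r, Ide Q (Cod Q r))))\<rparr>"

definition EM_prod ::
    "(('o, 'a) em_obj \<times> ('p, 'b) em_obj, ('o, 'a) em_arr \<times> ('p, 'b) em_arr,
      ('o \<times> 'p, 'a \<times> 'b) em_obj, ('o \<times> 'p, 'a \<times> 'b) em_arr) ftr" where
  "EM_prod =
     (let P = (\<lambda>((m, k), (n, l)). ((m, n), (k, l)))
      in \<lparr>omap = P, amap = (\<lambda>((x, f, y), (x', g, y')). (P (x, x'), (f, g), P (y, y')))\<rparr>)"

text \<open>The lifting \<open>C\<^sup>S \<times> Q \<rightarrow> D\<^sup>T\<close> of a 1-cell \<open>(C \<times> Q, S \<times> Q) \<rightarrow> (D, T)\<close>, and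
  the lifting \<open>Q \<times> D\<^sup>T \<rightarrow> C\<^sup>S\<close> of a 1-cell \<open>(Q \<times> D, Q \<times> T) \<rightarrow> (C, S)\<close>.\<close>

definition lift_ftr_right where
  "lift_ftr_right Q T cell = lift_ftr T cell \<circ>\<^sub>F EM_prod \<circ>\<^sub>F (id_ftr \<times>\<^sub>F EM_triv Q)"

definition lift_ftr_left where
  "lift_ftr_left Q S cell = lift_ftr S cell \<circ>\<^sub>F EM_prod \<circ>\<^sub>F (EM_triv Q \<times>\<^sub>F id_ftr)"


section \<open>Left Hopf 1-cells\<close>

text \<open>\<open>J(C \<times> U\<^sup>E)\<close> and \<open>K((U\<^sup>E)\<^sup>o\<^sup>p \<times> D)\<close>.\<close>

definition restrict_right ::
    "('o \<times> 'p, 'a \<times> 'r, 'd, 'b) ftr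
      \<Rightarrow> ('o \<times> ('p, 'r) em_obj, 'a \<times> ('p, 'r) em_arr, 'd, 'b) ftr" where
  "restrict_right J = J \<circ>\<^sub>F (id_ftr \<times>\<^sub>F EM_forget)"

definition restrict_left ::
    "('p \<times> 'd, 'r \<times> 'b, 'o, 'a) ftr
      \<Rightarrow> (('p, 'r) em_obj \<times> 'd, ('p, 'r) em_arr \<times> 'b, 'o, 'a) ftr" where
  "restrict_left K = K \<circ>\<^sub>F (EM_forget \<times>\<^sub>F id_ftr)"

fun hopf_map ::
    "('o, 'a) mnd \<Rightarrow> ('d, 'b) mnd \<Rightarrow> ('o \<times> 'p, 'a \<times> 'r, 'd, 'b) mnd_cell
      \<Rightarrow> 'o \<times> ('p, 'r) em_obj \<Rightarrow> 'b" where
  "hopf_map S T (J, \<psi>) (c, (m, k)) =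
     amap J (Ide (base S) (omap (endo S) c), k) \<cdot>\<^bsub>base T\<^esub> \<psi> (c, m)"

fun left_hopf ::
    "('o, 'a) mnd \<Rightarrow> ('p, 'r) mnd \<Rightarrow> ('d, 'b) mnd
      \<Rightarrow> ('o \<times> 'p, 'a \<times> 'r, 'd, 'b) mnd_cell \<Rightarrow> bool" where
  "left_hopf S E T (J, \<psi>) \<longleftrightarrow>
     nat_iso (base S \<times>\<^sub>C EM E) (base T)
       (endo T \<circ>\<^sub>F restrict_right J) (J \<circ>\<^sub>F (endo S \<times>\<^sub>F EM_forget)) (hopf_map S T (J, \<psi>))"

text \<open>\<open>H\<^sup>\<sharp>(\<psi>)\<close>: at \<open>x = (M, k)\<close>, the mate of the inverse of \<open>H(\<psi>)\<^bsub>(-, x)\<^esub>\<close> under \<open>J\<^sub>M \<stileturn> K\<^sub>M\<close>, where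
  \<open>\<eta>\<close> and \<open>\<epsilon>\<close> are the unit and counit of \<open>J \<stileturn>\<^sub>P K\<close>.\<close>

fun hopf_sharp ::
    "('o, 'a) mnd \<Rightarrow> ('p, 'r) mnd \<Rightarrow> ('d, 'b) mnd \<Rightarrow> ('o \<times> 'p, 'a \<times> 'r, 'd, 'b) mnd_cell
      \<Rightarrow> ('p \<times> 'd, 'r \<times> 'b, 'o, 'a) ftr \<Rightarrow> ('p \<Rightarrow> 'o \<Rightarrow> 'a) \<Rightarrow> ('p \<Rightarrow> 'd \<Rightarrow> 'b)
      \<Rightarrow> ('p, 'r) em_obj \<times> 'd \<Rightarrow> 'a" where
  "hopf_sharp S E T (J, \<psi>) K \<eta> \<epsilon> (x, d) =
     (let K\<^sub>M = fix_left (EM E) (restrict_left K) x; \<eta>\<^sub>M = \<eta> (fst x); \<epsilon>\<^sub>M = \<epsilon> (fst x)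
      in amap K\<^sub>M (amap (endo T) (\<epsilon>\<^sub>M d))
         \<cdot>\<^bsub>base S\<^esub> (amap K\<^sub>M (inv_arr (base T) (hopf_map S T (J, \<psi>) (omap K\<^sub>M d, x)))
         \<cdot>\<^bsub>base S\<^esub> \<eta>\<^sub>M (omap (endo S) (omap K\<^sub>M d))))"

end

theory Submission
  imports Defs
begin

text \<open>The bijection forgets the unit and counit of \<open>V \<stileturn>\<^sub>Q W\<close>. Nothing is lost: a 2-cell \<open>(\<alpha>, \<beta>)\<close> between
  liftings is determined by \<open>\<alpha>\<close>, because the compatibility condition fixes \<open>\<beta>\<close> on free algebras and
  the counit \<open>F\<^sup>S U\<^sup>S \<rightarrow> C\<^sup>S\<close>, which \<open>U\<^sup>S\<close> splits, carries this to all algebras, giving \<open>U\<^sup>T \<beta> = \<alpha> U\<^sup>S\<close>.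
  Conversely an \<open>\<alpha>\<close> lifts to such a \<open>\<beta>\<close> exactly if it is a 2-cell of monads, and a pair \<open>(B, \<psi>)\<close> is a
  1-cell of monads exactly if its lifting is a 1-cell of adjunctions. Equations between arrows of
  algebras, among them the one relating units and counits at different parameters, hold as soon as
  they hold for the underlying arrows.\<close>

text \<open>The 1-cell conditions are part of membership in both sets, so they are translated in
  both directions and not established. This works because liftings preserve underlying functors
  strictly: the mate of a lifted transformation consists of identities, hence is invertible, and
  what remains is that lifted algebras are algebras and that the lifted transformation is a natural
  family of algebra morphisms. The obstacle is equality. Functors and transformations are total
  functions without recorded source and target, so identities and composites of liftings agree with
  liftings of identities and composites only on actual algebras and arrows between them.
  \<open>lift_of\<close> and the assumptions on \<open>V\<close> and \<open>\<Lambda>\<close> inside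
  \<open>em_comparison\<close> ask for this agreement only. Units and counits, in contrast, must
  coincide as functions for \<open>fst\<close> to be injective; the normalisation in
  \<open>component_families\<close> provides that.\<close>

no_notation prod_filter (infixr "\<times>\<^sub>F" 80)

section \<open>Categories and functors\<close>

lemma ftr_eqI:
  fixes F G :: "('o, 'a, 'p, 'b) ftr"
  assumes "\<And>x. omap F x = omap G x" "\<And>f. amap F f = amap G f"
  shows "F = G"
  by (rule ftr.equality) (use assms in auto)

lemma omap_id_ftr [simp]: "omap id_ftr x = x"
  and amap_id_ftr [simp]: "amap id_ftr f = f"
  by (simp_all add: id_ftr_def)

lemma omap_comp_ftr [simp]: "omap (G \<circ>\<^sub>F F) x = omap G (omap F x)"
  and amap_comp_ftr [simp]: "amap (G \<circ>\<^sub>F F) f = amap G (amap F f)"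
  by (simp_all add: comp_ftr_def)

lemma omap_prod_ftr [simp]: "omap (F \<times>\<^sub>F G) p = (omap F (fst p), omap G (snd p))"
  and amap_prod_ftr [simp]: "amap (F \<times>\<^sub>F G) q = (amap F (fst q), amap G (snd q))"
  by (simp_all add: prod_ftr_def map_prod_def split: prod.splits)

lemma omap_fix_right [simp]: "omap (fix_right Q F q) c = omap F (c, q)"
  and amap_fix_right [simp]: "amap (fix_right Q F q) f = amap F (f, Ide Q q)"
  by (simp_all add: fix_right_def)

lemma omap_fix_left [simp]: "omap (fix_left Q F q) c = omap F (q, c)"
  and amap_fix_left [simp]: "amap (fix_left Q F q) f = amap F (Ide Q q, f)"
  by (simp_all add: fix_left_def)

lemma prod_cat_sel [simp]:
  "Obj (C \<times>\<^sub>C D) = Obj C \<times> Obj D" "Arr (C \<times>\<^sub>C D) = Arr C \<times> Arr D"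
  "Dom (C \<times>\<^sub>C D) p = (Dom C (fst p), Dom D (snd p))"
  "Cod (C \<times>\<^sub>C D) p = (Cod C (fst p), Cod D (snd p))"
  "Ide (C \<times>\<^sub>C D) a = (Ide C (fst a), Ide D (snd a))"
  "q \<cdot>\<^bsub>C \<times>\<^sub>C D\<^esub> p = (fst q \<cdot>\<^bsub>C\<^esub> fst p, snd q \<cdot>\<^bsub>D\<^esub> snd p)"
  by (simp_all add: prod_cat_def map_prod_def split: prod.splits)

lemma Hom_prod_cat [simp]:
  "Hom (C \<times>\<^sub>C D) a b = Hom C (fst a) (fst b) \<times> Hom D (snd a) (snd b)"
  by (cases a; cases b) (auto simp: Hom_def)

lemma op_cat_sel [simp]:
  "Obj (op_cat C) = Obj C" "Arr (op_cat C) = Arr C" "Dom (op_cat C) = Cod C"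
  "Cod (op_cat C) = Dom C" "Ide (op_cat C) = Ide C" "g \<cdot>\<^bsub>op_cat C\<^esub> f = f \<cdot>\<^bsub>C\<^esub> g"
  by (simp_all add: op_cat_def)

lemma Hom_op_cat [simp]: "Hom (op_cat C) a b = Hom C b a"
  by (auto simp: Hom_def)

lemma Hom_Arr: "f \<in> Hom C a b \<Longrightarrow> f \<in> Arr C"
  and Hom_Dom: "f \<in> Hom C a b \<Longrightarrow> Dom C f = a"
  and Hom_Cod: "f \<in> Hom C a b \<Longrightarrow> Cod C f = b"
  by (simp_all add: Hom_def)

lemmas HomD = Hom_Arr Hom_Dom Hom_Cod

text \<open>The axioms restated without free source and target objects, so that composability
  is checked by rewriting.\<close>

context category
begin

lemma Obj_of_Hom: "f \<in> Hom C a b \<Longrightarrow> a \<in> Obj C" "f \<in> Hom C a b \<Longrightarrow> b \<in> Obj C"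
  using dom_obj cod_obj by (auto simp: Hom_def)

lemma Ide_simps [simp]:
  assumes "a \<in> Obj C"
  shows "Ide C a \<in> Arr C" "Dom C (Ide C a) = a" "Cod C (Ide C a) = a"
  using ide_hom[OF assms] by (simp_all add: Hom_def)

lemma Cmp_simps [simp]:
  assumes "f \<in> Arr C" "g \<in> Arr C" "Dom C g = Cod C f"
  shows "g \<cdot> f \<in> Arr C" "Dom C (g \<cdot> f) = Dom C f" "Cod C (g \<cdot> f) = Cod C g"
  using cmp_hom[of f "Dom C f" "Cod C f" g "Cod C g"] assms by (simp_all add: Hom_def)

lemma Cmp_Ide [simp]:
  "\<lbrakk>f \<in> Arr C; Dom C f = a\<rbrakk> \<Longrightarrow> f \<cdot> Ide C a = f"
  "\<lbrakk>f \<in> Arr C; Cod C f = a\<rbrakk> \<Longrightarrow> Ide C a \<cdot> f = f"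
  using ide_right[of f] ide_left[of f] by (auto simp: Hom_def)

lemma Cmp_assoc [simp]:
  "\<lbrakk>f \<in> Arr C; g \<in> Arr C; h \<in> Arr C; Dom C g = Cod C f; Dom C h = Cod C g\<rbrakk>
    \<Longrightarrow> (h \<cdot> g) \<cdot> f = h \<cdot> (g \<cdot> f)"
  using cmp_assoc[of f "Dom C f" "Cod C f" g "Cod C g" h "Cod C h"] by (simp add: Hom_def)

end

lemma category_op:
  assumes "category C"
  shows "category (op_cat C)"
proof -
  interpret category C by fact
  show ?thesis
    by unfold_locales
      (auto simp: dom_obj cod_obj ide_hom intro: cmp_hom ide_left ide_right cmp_assoc[symmetric])
qed

lemma category_prod:
  assumes "category C" "category D"
  shows "category (C \<times>\<^sub>C D)"
proof -
  interpret C: category C by fact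
  interpret D: category D by fact
  show ?thesis
    by unfold_locales
      (auto simp: C.dom_obj D.dom_obj C.cod_obj D.cod_obj C.ide_hom D.ide_hom
        C.ide_right D.ide_right C.ide_left D.ide_left
        intro: C.cmp_hom D.cmp_hom C.cmp_assoc D.cmp_assoc)
qed

context cat_functor
begin

declare omap_obj [simp] amap_ide [simp]

lemma amap_simps [simp]:
  assumes "f \<in> Arr C"
  shows "amap F f \<in> Arr D" "Dom D (amap F f) = omap F (Dom C f)"
    "Cod D (amap F f) = omap F (Cod C f)"
  using amap_hom[of f "Dom C f" "Cod C f"] assms by (simp_all add: Hom_def)

text \<open>Kept out of the simp set because proofs use it in both directions: to split the image of
  a composite and, with \<open>flip\<close>, to fuse two images.\<close>

lemma amap_Cmp:
  "\<lbrakk>f \<in> Arr C; g \<in> Arr C; Dom C g = Cod C f\<rbrakk>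
    \<Longrightarrow> amap F (g \<cdot>\<^bsub>C\<^esub> f) = amap F g \<cdot>\<^bsub>D\<^esub> amap F f"
  using amap_cmp[of f "Dom C f" "Cod C f" g "Cod C g"] by (simp add: Hom_def)

end

section \<open>Functors and transformations: agreement, composites, products\<close>

text \<open>Functoriality only looks at objects and arrows of the source, so values of the record
  elsewhere may differ.\<close>

lemma functor_cong:
  assumes "cat_functor C D F"
    and "\<And>a. a \<in> Obj C \<Longrightarrow> omap G a = omap F a" "\<And>f. f \<in> Arr C \<Longrightarrow> amap G f = amap F f"
  shows "cat_functor C D G"
proof -
  interpret F: cat_functor C D F by fact
  show ?thesis
  proof
    fix f a b assume f: "f \<in> Hom C a b"
    show "amap G f \<in> Hom D (omap G a) (omap G b)"
      using f F.amap_hom[OF f] F.dom_cat.Obj_of_Hom[OF f] assms(2,3) by (simp add: HomD)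
  next
    fix f g a b c assume fg: "f \<in> Hom C a b" "g \<in> Hom C b c"
    then show "amap G (g \<cdot>\<^bsub>C\<^esub> f) = amap G g \<cdot>\<^bsub>D\<^esub> amap G f"
      using F.amap_cmp[OF fg] F.dom_cat.cmp_hom[OF fg] assms(3) by (simp add: HomD)
  qed (use assms(2,3) in \<open>auto simp: F.dom_cat.ide_hom\<close>)
qed

lemma functor_id: "category C \<Longrightarrow> cat_functor C C id_ftr"
  by (simp add: cat_functor_def cat_functor_axioms_def)

lemma functor_comp:
  assumes "cat_functor C D F" "cat_functor D E G"
  shows "cat_functor C E (G \<circ>\<^sub>F F)"
proof -
  interpret F: cat_functor C D F by fact
  interpret G: cat_functor D E G by fact
  show ?thesis
    by unfold_locales
      (auto simp: F.omap_obj G.omap_obj F.amap_ide G.amap_ide F.amap_cmp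
        intro: F.amap_hom G.amap_hom G.amap_cmp)
qed

lemma functor_prod:
  assumes "cat_functor C D F" "cat_functor C' D' F'"
  shows "cat_functor (C \<times>\<^sub>C C') (D \<times>\<^sub>C D') (F \<times>\<^sub>F F')"
proof -
  interpret F: cat_functor C D F by fact
  interpret F': cat_functor C' D' F' by fact
  interpret C: category "C \<times>\<^sub>C C'" by (rule category_prod) unfold_locales
  interpret D: category "D \<times>\<^sub>C D'" by (rule category_prod) unfold_locales
  show ?thesis
    by unfold_locales
      (auto simp: F.omap_obj F'.omap_obj F.amap_ide F'.amap_ide
        intro: F.amap_hom F'.amap_hom F.amap_cmp F'.amap_cmp)
qed

text \<open>Source and target enter through equations because in the uses they are not literally
  products: \<open>id_ftr\<close>, or a composite of two products, is one only after
  \<open>ftr_eqI\<close>.\<close>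

lemma nat_trans_prod:
  assumes "nat_trans C D F G \<tau>" "nat_trans C' D' F' G' \<tau>'"
    and F'': "F'' = prod_ftr F F'" and G'': "G'' = prod_ftr G G'"
  shows "nat_trans (C \<times>\<^sub>C C') (D \<times>\<^sub>C D') F'' G'' (map_prod \<tau> \<tau>')"
proof -
  interpret \<tau>: nat_trans C D F G \<tau> by fact
  interpret \<tau>': nat_trans C' D' F' G' \<tau>' by fact
  interpret F: cat_functor "C \<times>\<^sub>C C'" "D \<times>\<^sub>C D'" "F \<times>\<^sub>F F'"
    by (rule functor_prod) unfold_locales
  interpret G: cat_functor "C \<times>\<^sub>C C'" "D \<times>\<^sub>C D'" "G \<times>\<^sub>F G'"
    by (rule functor_prod) unfold_locales
  show ?thesis
    unfolding F'' G''
    by unfold_locales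
      (auto intro: \<tau>.component \<tau>'.component \<tau>.naturality \<tau>'.naturality)
qed

lemma (in nat_trans) component_simps [simp]:
  assumes "a \<in> Obj C"
  shows "\<tau> a \<in> Arr D" "Dom D (\<tau> a) = omap F a" "Cod D (\<tau> a) = omap G a"
  using component[OF assms] by (simp_all add: Hom_def)

lemma (in nat_trans) naturality_Arr:
  "f \<in> Arr C \<Longrightarrow> amap G f \<cdot>\<^bsub>D\<^esub> \<tau> (Dom C f) = \<tau> (Cod C f) \<cdot>\<^bsub>D\<^esub> amap F f"
  by (rule naturality) (simp add: Hom_def)

lemma nat_trans_Ide:
  assumes "cat_functor C D F" "cat_functor C D G"
    and "\<And>a. a \<in> Obj C \<Longrightarrow> omap F a = omap G a"
    and "\<And>f. f \<in> Arr C \<Longrightarrow> amap F f = amap G f"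
    and "\<And>a. a \<in> Obj C \<Longrightarrow> \<tau> a = Ide D (omap F a)"
  shows "nat_trans C D F G \<tau>"
proof -
  interpret F: cat_functor C D F by fact
  interpret G: cat_functor C D G by fact
  show ?thesis
  proof
    fix a assume "a \<in> Obj C"
    then show "\<tau> a \<in> Hom D (omap F a) (omap G a)"
      using assms(3,5) F.cod_cat.ide_hom F.omap_obj by simp
  next
    fix f a b assume f: "f \<in> Hom C a b"
    then have "a \<in> Obj C" "b \<in> Obj C" by (auto dest: F.dom_cat.Obj_of_Hom)
    moreover have "amap F f \<in> Hom D (omap F a) (omap F b)" using f by (rule F.amap_hom)
    ultimately show "amap G f \<cdot>\<^bsub>D\<^esub> \<tau> a = \<tau> b \<cdot>\<^bsub>D\<^esub> amap F f"
      using assms(3,5) assms(4)[OF Hom_Arr[OF f]]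
      by (simp add: F.cod_cat.ide_right F.cod_cat.ide_left)
  qed
qed

section \<open>Identity and product adjunctions\<close>

lemma adj_0cell_id: "category Q \<Longrightarrow> adj_0cell (id_adj Q)"
  unfolding adj_0cell_def id_adj_def adjunction_def adjunction_axioms_def
  by (auto intro!: nat_trans_Ide functor_id functor_comp simp: category.Ide_simps category.Cmp_Ide)

lemma prod_adj_sel [simp]:
  "adom (A \<times>\<^sub>A B) = adom A \<times>\<^sub>C adom B" "acod (A \<times>\<^sub>A B) = acod A \<times>\<^sub>C acod B"
  "aleft (A \<times>\<^sub>A B) = aleft A \<times>\<^sub>F aleft B" "aright (A \<times>\<^sub>A B) = aright A \<times>\<^sub>F aright B"
  "aunit (A \<times>\<^sub>A B) = map_prod (aunit A) (aunit B)"
  "acounit (A \<times>\<^sub>A B) = map_prod (acounit A) (acounit B)"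
  by (simp_all add: prod_adj_def)

lemma id_adj_sel [simp]:
  "adom (id_adj Q) = Q" "acod (id_adj Q) = Q" "aleft (id_adj Q) = id_ftr"
  "aright (id_adj Q) = id_ftr" "aunit (id_adj Q) = Ide Q" "acounit (id_adj Q) = Ide Q"
  by (simp_all add: id_adj_def)

lemma adj_0cell_prod:
  assumes "adj_0cell A" "adj_0cell B"
  shows "adj_0cell (A \<times>\<^sub>A B)"
proof -
  interpret A: adjunction "adom A" "acod A" "aleft A" "aright A" "aunit A" "acounit A"
    using assms(1) by (simp add: adj_0cell_def)
  interpret B: adjunction "adom B" "acod B" "aleft B" "aright B" "aunit B" "acounit B"
    using assms(2) by (simp add: adj_0cell_def)
  show ?thesis
    unfolding adj_0cell_def adjunction_def adjunction_axioms_def prod_adj_sel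
    by (intro conjI allI impI functor_prod A.left.cat_functor_axioms A.right.cat_functor_axioms
          B.left.cat_functor_axioms B.right.cat_functor_axioms
          nat_trans_prod[OF A.unit.nat_trans_axioms B.unit.nat_trans_axioms]
          nat_trans_prod[OF A.counit.nat_trans_axioms B.counit.nat_trans_axioms])
      (auto intro!: ftr_eqI simp: A.triangle_left B.triangle_left A.triangle_right B.triangle_right)
qed

section \<open>Monads and Eilenberg--Moore categories\<close>

text \<open>Locale form of \<open>is_monad\<close>, so that functoriality and naturality of the
  structure are available through \<open>interpret\<close>.\<close>

locale monad =
    endo: cat_functor "base S" "base S" "endo S" +
    mult: nat_trans "base S" "base S" "endo S \<circ>\<^sub>F endo S" "endo S" "mult S" +
    unit: nat_trans "base S" "base S" id_ftr "endo S" "unit S"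
  for S :: "('o, 'a) mnd" +
  assumes mult_assoc: "c \<in> Obj (base S) \<Longrightarrow>
      mult S c \<cdot>\<^bsub>base S\<^esub> mult S (omap (endo S) c)
        = mult S c \<cdot>\<^bsub>base S\<^esub> amap (endo S) (mult S c)"
    and mult_unit_left: "c \<in> Obj (base S) \<Longrightarrow>
      mult S c \<cdot>\<^bsub>base S\<^esub> unit S (omap (endo S) c) = Ide (base S) (omap (endo S) c)"
    and mult_unit_right: "c \<in> Obj (base S) \<Longrightarrow>
      mult S c \<cdot>\<^bsub>base S\<^esub> amap (endo S) (unit S c) = Ide (base S) (omap (endo S) c)"

lemma is_monad_iff: "is_monad S \<longleftrightarrow> monad S"
  by (auto simp: is_monad_def monad_def monad_axioms_def)

locale monad_cell =
    source: monad S + target: monad T + func: cat_functor "base S" "base T" B +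
    trans: nat_trans "base S" "base T" "endo T \<circ>\<^sub>F B" "B \<circ>\<^sub>F endo S" \<psi>
  for S :: "('o, 'a) mnd" and T :: "('p, 'b) mnd" and B \<psi> +
  assumes cell_mult: "c \<in> Obj (base S) \<Longrightarrow>
      \<psi> c \<cdot>\<^bsub>base T\<^esub> mult T (omap B c)
        = amap B (mult S c) \<cdot>\<^bsub>base T\<^esub> (\<psi> (omap (endo S) c) \<cdot>\<^bsub>base T\<^esub> amap (endo T) (\<psi> c))"
    and cell_unit: "c \<in> Obj (base S) \<Longrightarrow>
      \<psi> c \<cdot>\<^bsub>base T\<^esub> unit T (omap B c) = amap B (unit S c)"

lemma mnd_1cell_iff: "mnd_1cell S T (B, \<psi>) \<longleftrightarrow> monad_cell S T B \<psi>"
  by (auto simp: is_monad_iff monad_cell_def monad_cell_axioms_def)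

lemma algebras_iff:
  "x \<in> algebras S \<longleftrightarrow> fst x \<in> Obj (base S) \<and> snd x \<in> Arr (base S)
     \<and> Dom (base S) (snd x) = omap (endo S) (fst x) \<and> Cod (base S) (snd x) = fst x
     \<and> snd x \<cdot>\<^bsub>base S\<^esub> mult S (fst x) = snd x \<cdot>\<^bsub>base S\<^esub> amap (endo S) (snd x)
     \<and> snd x \<cdot>\<^bsub>base S\<^esub> unit S (fst x) = Ide (base S) (fst x)"
  by (auto simp: algebras_def Hom_def split: prod.splits)

lemma algebra_simps_EM [simp]:
  assumes "x \<in> algebras S"
  shows "fst x \<in> Obj (base S)" "snd x \<in> Arr (base S)"
    "Dom (base S) (snd x) = omap (endo S) (fst x)" "Cod (base S) (snd x) = fst x"
    "snd x \<cdot>\<^bsub>base S\<^esub> unit S (fst x) = Ide (base S) (fst x)"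
  using assms by (simp_all add: algebras_iff)

lemma algebra_mult: "x \<in> algebras S \<Longrightarrow>
    snd x \<cdot>\<^bsub>base S\<^esub> mult S (fst x) = snd x \<cdot>\<^bsub>base S\<^esub> amap (endo S) (snd x)"
  unfolding algebras_iff by blast

lemma EM_sel [simp]:
  "Obj (EM S) = algebras S" "Dom (EM S) f = fst f" "Cod (EM S) f = snd (snd f)"
  "Ide (EM S) x = (x, Ide (base S) (fst x), x)"
  "g \<cdot>\<^bsub>EM S\<^esub> f = (fst f, fst (snd g) \<cdot>\<^bsub>base S\<^esub> fst (snd f), snd (snd g))"
  by (simp_all add: EM_def split: prod.splits)

lemma Hom_EM_I:
  "\<lbrakk>x \<in> algebras S; y \<in> algebras S; f \<in> Arr (base S); Dom (base S) f = fst x;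
     Cod (base S) f = fst y; f \<cdot>\<^bsub>base S\<^esub> snd x = snd y \<cdot>\<^bsub>base S\<^esub> amap (endo S) f\<rbrakk>
    \<Longrightarrow> (x, f, y) \<in> Hom (EM S) x y"
  by (simp add: EM_def Hom_def)

lemma Hom_EM_E:
  assumes "h \<in> Hom (EM S) x y"
  obtains f where "h = (x, f, y)" "x \<in> algebras S" "y \<in> algebras S" "f \<in> Arr (base S)"
    "Dom (base S) f = fst x" "Cod (base S) f = fst y"
    "f \<cdot>\<^bsub>base S\<^esub> snd x = snd y \<cdot>\<^bsub>base S\<^esub> amap (endo S) f"
  using assms by (auto simp: EM_def Hom_def)

lemma EM_forget_sel [simp]: "omap EM_forget x = fst x" "amap EM_forget f = fst (snd f)"
  by (simp_all add: EM_forget_def split: prod.splits)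

lemma EM_free_sel [simp]:
  "omap (EM_free S) c = (omap (endo S) c, mult S c)"
  "amap (EM_free S) f = (omap (EM_free S) (Dom (base S) f), amap (endo S) f,
     omap (EM_free S) (Cod (base S) f))"
  by (simp_all add: EM_free_def)

lemma EM_adj_sel [simp]:
  "adom (EM_adj S) = base S" "acod (EM_adj S) = EM S" "aleft (EM_adj S) = EM_free S"
  "aright (EM_adj S) = EM_forget" "aunit (EM_adj S) = unit S"
  "acounit (EM_adj S) x = (omap (EM_free S) (fst x), snd x, x)"
  by (simp_all add: EM_adj_def split: prod.splits)

context monad
begin

lemma category_EM: "category (EM S)"
proof
  fix h assume "h \<in> Arr (EM S)"
  then show "Dom (EM S) h \<in> Obj (EM S)" "Cod (EM S) h \<in> Obj (EM S)"
    by (auto simp: EM_def)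
next
  fix x assume "x \<in> Obj (EM S)"
  then show "Ide (EM S) x \<in> Hom (EM S) x x" by (simp add: Hom_EM_I)
next
  fix h h' x y z assume "h \<in> Hom (EM S) x y" "h' \<in> Hom (EM S) y z"
  then obtain f g where h: "h = (x, f, y)" "h' = (y, g, z)"
    and alg: "x \<in> algebras S" "y \<in> algebras S" "z \<in> algebras S"
    and f: "f \<in> Arr (base S)" "Dom (base S) f = fst x" "Cod (base S) f = fst y"
    and g: "g \<in> Arr (base S)" "Dom (base S) g = fst y" "Cod (base S) g = fst z"
    and fE: "f \<cdot>\<^bsub>base S\<^esub> snd x = snd y \<cdot>\<^bsub>base S\<^esub> amap (endo S) f"
    and gE: "g \<cdot>\<^bsub>base S\<^esub> snd y = snd z \<cdot>\<^bsub>base S\<^esub> amap (endo S) g"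
    by (auto elim!: Hom_EM_E)
  have "(g \<cdot>\<^bsub>base S\<^esub> f) \<cdot>\<^bsub>base S\<^esub> snd x
      = (g \<cdot>\<^bsub>base S\<^esub> snd y) \<cdot>\<^bsub>base S\<^esub> amap (endo S) f"
    using alg f g by (simp add: fE)
  also have "\<dots> = snd z \<cdot>\<^bsub>base S\<^esub> amap (endo S) (g \<cdot>\<^bsub>base S\<^esub> f)"
    using alg f g by (simp add: gE endo.amap_Cmp)
  finally have "(x, g \<cdot>\<^bsub>base S\<^esub> f, z) \<in> Hom (EM S) x z"
    using alg f g by (intro Hom_EM_I) simp_all
  then show "h' \<cdot>\<^bsub>EM S\<^esub> h \<in> Hom (EM S) x z" by (simp add: h)
qed (auto elim!: Hom_EM_E)

lemma free_algebra: "c \<in> Obj (base S) \<Longrightarrow> (omap (endo S) c, mult S c) \<in> algebras S"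
  unfolding algebras_iff by (simp add: mult_assoc mult_unit_left)

lemma functor_free: "cat_functor (base S) (EM S) (EM_free S)"
proof -
  interpret EM: category "EM S" by (rule category_EM)
  show ?thesis
  proof
    fix f a b assume f: "f \<in> Hom (base S) a b"
    then have "amap (endo S) f \<cdot>\<^bsub>base S\<^esub> mult S a
        = mult S b \<cdot>\<^bsub>base S\<^esub> amap (endo S) (amap (endo S) f)"
      using mult.naturality[of f a b] by simp
    then show "amap (EM_free S) f \<in> Hom (EM S) (omap (EM_free S) a) (omap (EM_free S) b)"
      using f endo.dom_cat.Obj_of_Hom[OF f] by (auto simp: free_algebra HomD intro!: Hom_EM_I)
  qed (auto simp: free_algebra endo.amap_Cmp HomD)
qed

lemma functor_forget: "cat_functor (EM S) (base S) EM_forget"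
proof -
  interpret EM: category "EM S" by (rule category_EM)
  show ?thesis
  proof
    fix h x y assume "h \<in> Hom (EM S) x y"
    then show "amap EM_forget h \<in> Hom (base S) (omap EM_forget x) (omap EM_forget y)"
      by (rule Hom_EM_E) (simp add: Hom_def)
  qed auto
qed

text \<open>The counit at an algebra is its structure map. That it is a morphism is the
  associativity law of the algebra, its naturality is the defining square of algebra morphisms, and
  the triangles are a unit law of the monad and the unit law of the algebra.\<close>

lemma adj_0cell_EM: "adj_0cell (EM_adj S)"
proof -
  interpret free: cat_functor "base S" "EM S" "EM_free S" by (rule functor_free)
  interpret forget: cat_functor "EM S" "base S" EM_forget by (rule functor_forget)
  interpret UF: cat_functor "base S" "base S" "EM_forget \<circ>\<^sub>F EM_free S"
    by (rule functor_comp) unfold_locales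
  interpret FU: cat_functor "EM S" "EM S" "EM_free S \<circ>\<^sub>F EM_forget"
    by (rule functor_comp) unfold_locales
  interpret IB: cat_functor "base S" "base S" id_ftr by (rule functor_id) unfold_locales
  interpret IE: cat_functor "EM S" "EM S" id_ftr by (rule functor_id) unfold_locales
  show ?thesis
    unfolding adj_0cell_def EM_adj_sel(1-5)
  proof
    fix c assume c: "c \<in> Obj (base S)"
    then show "unit S c \<in> Hom (base S) (omap id_ftr c) (omap (EM_forget \<circ>\<^sub>F EM_free S) c)"
      by (simp add: Hom_def)
    show "acounit (EM_adj S) (omap (EM_free S) c) \<cdot>\<^bsub>EM S\<^esub> amap (EM_free S) (unit S c)
        = Ide (EM S) (omap (EM_free S) c)"
      using c by (simp add: mult_unit_right)
  next
    fix f a b assume f: "f \<in> Hom (base S) a b"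
    then show "amap (EM_forget \<circ>\<^sub>F EM_free S) f \<cdot>\<^bsub>base S\<^esub> unit S a
        = unit S b \<cdot>\<^bsub>base S\<^esub> amap id_ftr f"
      using unit.naturality[OF f] by simp
  next
    fix x assume "x \<in> Obj (EM S)"
    then have x: "x \<in> algebras S" by simp
    show "acounit (EM_adj S) x \<in> Hom (EM S) (omap (EM_free S \<circ>\<^sub>F EM_forget) x) (omap id_ftr x)"
      using x by (auto simp: free_algebra algebra_mult intro!: Hom_EM_I)
    show "amap EM_forget (acounit (EM_adj S) x) \<cdot>\<^bsub>base S\<^esub> unit S (omap EM_forget x)
        = Ide (base S) (omap EM_forget x)"
      using x by simp
  next
    fix h x y assume "h \<in> Hom (EM S) x y"
    then show "amap id_ftr h \<cdot>\<^bsub>EM S\<^esub> acounit (EM_adj S) x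
        = acounit (EM_adj S) y \<cdot>\<^bsub>EM S\<^esub> amap (EM_free S \<circ>\<^sub>F EM_forget) h"
      by (auto elim!: Hom_EM_E)
  qed
qed

end

section \<open>Liftings\<close>

lemma lift_ftr_sel [simp]:
  "omap (lift_ftr T (B, \<psi>)) x = (omap B (fst x), amap B (snd x) \<cdot>\<^bsub>base T\<^esub> \<psi> (fst x))"
  "amap (lift_ftr T (B, \<psi>)) f = (omap (lift_ftr T (B, \<psi>)) (fst f), amap B (fst (snd f)),
     omap (lift_ftr T (B, \<psi>)) (snd (snd f)))"
  by (simp_all add: Let_def split: prod.splits)

declare lift_ftr.simps [simp del]

lemma lift_trans_eq [simp]:
  "lift_trans S T (B, \<psi>) c = ((omap (endo T) (omap B c), mult T (omap B c)), \<psi> c,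
     (omap B (omap (endo S) c), amap B (mult S c) \<cdot>\<^bsub>base T\<^esub> \<psi> (omap (endo S) c)))"
  by simp

declare lift_trans.simps [simp del]

text \<open>Associativity of a lifted algebra combines \<open>cell_mult\<close>, associativity of
  the given algebra and naturality of \<open>\<psi>\<close> at its structure map; its unit law comes
  from \<open>cell_unit\<close>. Naturality of \<open>\<psi>\<close> at \<open>f\<close> makes
  \<open>amap B f\<close> a morphism.\<close>

lemma (in monad_cell) functor_lift: "cat_functor (EM S) (EM T) (lift_ftr T (B, \<psi>))"
proof -
  interpret ES: category "EM S" by (rule source.category_EM)
  interpret ET: category "EM T" by (rule target.category_EM)
  have obj: "omap (lift_ftr T (B, \<psi>)) x \<in> algebras T" if x: "x \<in> algebras S" for x
  proof -
    let ?m = "fst x" and ?k = "snd x"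
    have "amap B ?k \<cdot>\<^bsub>base T\<^esub> (\<psi> ?m \<cdot>\<^bsub>base T\<^esub> mult T (omap B ?m))
        = amap B (?k \<cdot>\<^bsub>base S\<^esub> mult S ?m) \<cdot>\<^bsub>base T\<^esub>
            (\<psi> (omap (endo S) ?m) \<cdot>\<^bsub>base T\<^esub> amap (endo T) (\<psi> ?m))"
      using x by (simp add: cell_mult func.amap_Cmp)
    also have "\<dots> = amap B ?k \<cdot>\<^bsub>base T\<^esub>
        ((amap B (amap (endo S) ?k) \<cdot>\<^bsub>base T\<^esub> \<psi> (omap (endo S) ?m)) \<cdot>\<^bsub>base T\<^esub> amap (endo T) (\<psi> ?m))"
      using x by (simp add: algebra_mult func.amap_Cmp)
    also have "amap B (amap (endo S) ?k) \<cdot>\<^bsub>base T\<^esub> \<psi> (omap (endo S) ?m)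
        = \<psi> ?m \<cdot>\<^bsub>base T\<^esub> amap (endo T) (amap B ?k)"
      using x trans.naturality_Arr[of ?k] by simp
    finally have "amap B ?k \<cdot>\<^bsub>base T\<^esub> (\<psi> ?m \<cdot>\<^bsub>base T\<^esub> mult T (omap B ?m))
        = amap B ?k \<cdot>\<^bsub>base T\<^esub> (\<psi> ?m \<cdot>\<^bsub>base T\<^esub>
            (amap (endo T) (amap B ?k) \<cdot>\<^bsub>base T\<^esub> amap (endo T) (\<psi> ?m)))"
      using x by simp
    moreover have "amap B ?k \<cdot>\<^bsub>base T\<^esub> amap B (unit S ?m) = Ide (base T) (omap B ?m)"
      using x by (simp flip: func.amap_Cmp)
    ultimately show ?thesis
      unfolding algebras_iff using x by (simp add: target.endo.amap_Cmp cell_unit)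
  qed
  show ?thesis
  proof
    fix x assume "x \<in> Obj (EM S)"
    then show "omap (lift_ftr T (B, \<psi>)) x \<in> Obj (EM T)" using obj[of x] by simp
  next
    fix h x y assume "h \<in> Hom (EM S) x y"
    then obtain f where h: "h = (x, f, y)" and alg: "x \<in> algebras S" "y \<in> algebras S"
      and f: "f \<in> Arr (base S)" "Dom (base S) f = fst x" "Cod (base S) f = fst y"
      and fE: "f \<cdot>\<^bsub>base S\<^esub> snd x = snd y \<cdot>\<^bsub>base S\<^esub> amap (endo S) f"
      by (auto elim!: Hom_EM_E)
    have "amap B f \<cdot>\<^bsub>base T\<^esub> (amap B (snd x) \<cdot>\<^bsub>base T\<^esub> \<psi> (fst x))
        = amap B (f \<cdot>\<^bsub>base S\<^esub> snd x) \<cdot>\<^bsub>base T\<^esub> \<psi> (fst x)"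
      using alg f by (simp add: func.amap_Cmp)
    also have "\<dots> = amap B (snd y) \<cdot>\<^bsub>base T\<^esub> (amap B (amap (endo S) f) \<cdot>\<^bsub>base T\<^esub> \<psi> (fst x))"
      using alg f by (simp add: fE func.amap_Cmp)
    also have "amap B (amap (endo S) f) \<cdot>\<^bsub>base T\<^esub> \<psi> (fst x)
        = \<psi> (fst y) \<cdot>\<^bsub>base T\<^esub> amap (endo T) (amap B f)"
      using f trans.naturality_Arr[of f] by simp
    finally show "amap (lift_ftr T (B, \<psi>)) h
        \<in> Hom (EM T) (omap (lift_ftr T (B, \<psi>)) x) (omap (lift_ftr T (B, \<psi>)) y)"
      unfolding h lift_ftr_sel(2) fst_conv snd_conv
      using alg f obj[OF alg(1)] obj[OF alg(2)] by (intro Hom_EM_I) simp_all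
  qed (auto simp: func.amap_Cmp elim!: Hom_EM_E)
qed

text \<open>\<open>N\<close> abstracts the identification of \<open>C\<^sup>S \<times> Q\<close> and \<open>Q \<times> D\<^sup>T\<close> with categories of algebras,
  so that liftings along both of them are treated at once.\<close>

locale em_comparison =
    monad P + adj: adjunction "base P" "acod A" "aleft A" "aright A" "unit P" "acounit A" +
    cmp: cat_functor "acod A" "EM P" N
  for P :: "('o, 'a) mnd" and A :: "('o, 'a, 'x, 'b) adj" and N +
  assumes adom_eq: "adom A = base P" and aunit_eq: "aunit A = unit P"
    and cmp_free: "c \<in> Obj (base P) \<Longrightarrow> omap N (omap (aleft A) c) = omap (EM_free P) c"
    and cmp_free_amap: "f \<in> Arr (base P) \<Longrightarrow> amap N (amap (aleft A) f) = amap (EM_free P) f"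
    and forget_cmp: "x \<in> Obj (acod A) \<Longrightarrow> fst (omap N x) = omap (aright A) x"
    and forget_cmp_amap: "h \<in> Arr (acod A) \<Longrightarrow> fst (snd (amap N h)) = amap (aright A) h"
    and forget_counit: "x \<in> Obj (acod A) \<Longrightarrow> amap (aright A) (acounit A x) = snd (omap N x)"
begin

text \<open>\<open>V\<close> and \<open>\<Lambda>\<close> stay variables, tied to the lifting
  pointwise, so that the results also cover identities and composites of liftings, whose records
  need not equal a lifting.\<close>

context
  fixes T :: "('p, 'd) mnd" and B \<psi>
    and V :: "('x, 'b, ('p, 'd) em_obj, ('p, 'd) em_arr) ftr" and \<Lambda>
  assumes omap_lift: "x \<in> Obj (acod A) \<Longrightarrow> omap V x = omap (lift_ftr T (B, \<psi>)) (omap N x)"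
    and amap_lift: "h \<in> Arr (acod A) \<Longrightarrow> amap V h = amap (lift_ftr T (B, \<psi>)) (amap N h)"
    and trans_lift: "c \<in> Obj (base P) \<Longrightarrow> \<Lambda> c = lift_trans P T (B, \<psi>) c"
begin

text \<open>The law \<open>cell_mult\<close> says exactly that \<open>\<Lambda> c\<close> is a
  morphism of algebras, and \<open>cell_unit\<close> makes the mate trivial.\<close>

lemma adjR_1cell_of_monad_cell:
  assumes "monad_cell P T B \<psi>"
  shows "adjR_1cell A (EM_adj T) (B, V, \<Lambda>)"
proof -
  interpret monad_cell P T B \<psi> by fact
  interpret lift: cat_functor "EM P" "EM T" "lift_ftr T (B, \<psi>)" by (rule functor_lift)
  interpret LN: cat_functor "acod A" "EM T" "lift_ftr T (B, \<psi>) \<circ>\<^sub>F N"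
    by (rule functor_comp) unfold_locales
  interpret V: cat_functor "acod A" "EM T" V
    by (rule functor_cong[OF LN.cat_functor_axioms]) (simp_all only: omap_comp_ftr amap_comp_ftr omap_lift amap_lift)
  interpret free: cat_functor "base T" "EM T" "EM_free T" by (rule target.functor_free)
  interpret forget: cat_functor "EM T" "base T" EM_forget by (rule target.functor_forget)
  interpret FB: cat_functor "base P" "EM T" "EM_free T \<circ>\<^sub>F B" by (rule functor_comp) unfold_locales
  interpret VL: cat_functor "base P" "EM T" "V \<circ>\<^sub>F aleft A" by (rule functor_comp) unfold_locales
  interpret BR: cat_functor "acod A" "base T" "B \<circ>\<^sub>F aright A" by (rule functor_comp) unfold_locales
  interpret UV: cat_functor "acod A" "base T" "EM_forget \<circ>\<^sub>F V" by (rule functor_comp) unfold_locales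
  have VL: "omap V (omap (aleft A) c) = omap (lift_ftr T (B, \<psi>)) (omap (EM_free P) c)"
    if "c \<in> Obj (base P)" for c
    using that by (simp only: omap_lift cmp_free adj.left.omap_obj)
  have nat: "nat_trans (base P) (EM T) (EM_free T \<circ>\<^sub>F B) (V \<circ>\<^sub>F aleft A) \<Lambda>"
  proof
    fix c assume c: "c \<in> Obj (base P)"
    have "omap (lift_ftr T (B, \<psi>)) (omap (EM_free P) c) \<in> algebras T"
      using c lift.omap_obj[of "omap (EM_free P) c"] free_algebra[OF c] by simp
    then show "\<Lambda> c \<in> Hom (EM T) (omap (EM_free T \<circ>\<^sub>F B) c) (omap (V \<circ>\<^sub>F aleft A) c)"
      using c target.free_algebra[of "omap B c"]
      by (auto simp: trans_lift VL cell_mult intro!: Hom_EM_I)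
  next
    fix f a b assume f: "f \<in> Hom (base P) a b"
    have ab: "a \<in> Obj (base P)" "b \<in> Obj (base P)" using f by (auto dest: endo.dom_cat.Obj_of_Hom)
    show "amap (V \<circ>\<^sub>F aleft A) f \<cdot>\<^bsub>EM T\<^esub> \<Lambda> a = \<Lambda> b \<cdot>\<^bsub>EM T\<^esub> amap (EM_free T \<circ>\<^sub>F B) f"
      using trans.naturality[OF f] f ab by (simp add: HomD amap_lift cmp_free_amap trans_lift)
  qed
  \<comment> \<open>By \<open>cell_unit\<close> the mate becomes \<open>B\<close> applied to the
    structure map after the unit, which the unit law of the algebra \<open>omap N x\<close> reduces
    to an identity.\<close>
  have mate: "adj_mate A (EM_adj T) (B, V, \<Lambda>) x = Ide (base T) (omap (B \<circ>\<^sub>F aright A) x)"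
    if x: "x \<in> Obj (acod A)" for x
  proof -
    have alg: "omap N x \<in> algebras P" using cmp.omap_obj[OF x] by simp
    have "adj_mate A (EM_adj T) (B, V, \<Lambda>) x
        = amap B (snd (omap N x)) \<cdot>\<^bsub>base T\<^esub> amap B (unit P (fst (omap N x)))"
      using x by (simp add: amap_lift forget_cmp_amap forget_counit trans_lift cell_unit forget_cmp)
    also have "\<dots> = amap B (snd (omap N x) \<cdot>\<^bsub>base P\<^esub> unit P (fst (omap N x)))"
      using alg by (intro func.amap_Cmp[symmetric]) simp_all
    also have "\<dots> = Ide (base T) (omap B (fst (omap N x)))" using alg by simp
    finally show ?thesis using x by (simp only: forget_cmp omap_comp_ftr)
  qed
  \<comment> \<open>Both directions are recorded because the mate, consisting of identities, serves
    below as its own inverse.\<close>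
  have "nat_trans (acod A) (base T) (B \<circ>\<^sub>F aright A) (EM_forget \<circ>\<^sub>F V) (adj_mate A (EM_adj T) (B, V, \<Lambda>))"
    and "nat_trans (acod A) (base T) (EM_forget \<circ>\<^sub>F V) (B \<circ>\<^sub>F aright A) (adj_mate A (EM_adj T) (B, V, \<Lambda>))"
    by (rule nat_trans_Ide; (rule BR.cat_functor_axioms UV.cat_functor_axioms)?;
      simp only: mate omap_comp_ftr amap_comp_ftr EM_forget_sel omap_lift amap_lift
        lift_ftr_sel fst_conv snd_conv forget_cmp forget_cmp_amap)+
  moreover have "Ide (base T) (omap (B \<circ>\<^sub>F aright A) x) \<cdot>\<^bsub>base T\<^esub> Ide (base T) (omap (B \<circ>\<^sub>F aright A) x)
      = Ide (base T) (omap (B \<circ>\<^sub>F aright A) x)" if "x \<in> Obj (acod A)" for x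
    using that by simp
  ultimately have "nat_iso (acod A) (base T) (B \<circ>\<^sub>F aright A) (EM_forget \<circ>\<^sub>F V)
      (adj_mate A (EM_adj T) (B, V, \<Lambda>))"
    unfolding nat_iso_def
    by (intro conjI exI[of _ "adj_mate A (EM_adj T) (B, V, \<Lambda>)"] ballI)
      (simp_all add: mate omap_lift forget_cmp del: adj_mate.simps)
  then show ?thesis
    using nat target.adj_0cell_EM adj.adjunction_axioms V.cat_functor_axioms func.cat_functor_axioms
    by (simp add: adj_0cell_def adom_eq aunit_eq del: adj_mate.simps)
qed

text \<open>The two laws have different origins: \<open>cell_mult\<close> holds because
  \<open>\<Lambda> c\<close> is a morphism of algebras, whereas \<open>cell_unit\<close> holds
  because its target, the lifted free algebra, satisfies the unit law of an algebra.\<close>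

lemma monad_cell_of_adjR_1cell:
  assumes "monad T" and "adjR_1cell A (EM_adj T) (B, V, \<Lambda>)"
  shows "monad_cell P T B \<psi>"
proof -
  interpret T: monad T by fact
  interpret B: cat_functor "base P" "base T" B using assms(2) by (simp add: adom_eq)
  interpret \<Lambda>: nat_trans "base P" "EM T" "EM_free T \<circ>\<^sub>F B" "V \<circ>\<^sub>F aleft A" \<Lambda>
    using assms(2) by (simp add: adom_eq)
  interpret TB: cat_functor "base P" "base T" "endo T \<circ>\<^sub>F B" by (rule functor_comp) unfold_locales
  interpret BP: cat_functor "base P" "base T" "B \<circ>\<^sub>F endo P" by (rule functor_comp) unfold_locales
  \<comment> \<open>Membership in this hom-set carries the typing of \<open>\<psi>\<close>, the
    algebra laws of the lifted free algebra and the morphism square, all extracted next.\<close>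
  have hom: "lift_trans P T (B, \<psi>) c
      \<in> Hom (EM T) (omap (EM_free T) (omap B c)) (omap (lift_ftr T (B, \<psi>)) (omap (EM_free P) c))"
    if c: "c \<in> Obj (base P)" for c
    using \<Lambda>.component[OF c] c
    by (simp only: omap_comp_ftr trans_lift omap_lift cmp_free adj.left.omap_obj)
  have \<psi>: "\<psi> c \<in> Arr (base T)" "Dom (base T) (\<psi> c) = omap (endo T) (omap B c)"
      "Cod (base T) (\<psi> c) = omap B (omap (endo P) c)"
    and alg: "(omap B (omap (endo P) c), amap B (mult P c) \<cdot>\<^bsub>base T\<^esub> \<psi> (omap (endo P) c)) \<in> algebras T"
    and mult: "\<psi> c \<cdot>\<^bsub>base T\<^esub> mult T (omap B c)
      = (amap B (mult P c) \<cdot>\<^bsub>base T\<^esub> \<psi> (omap (endo P) c)) \<cdot>\<^bsub>base T\<^esub> amap (endo T) (\<psi> c)"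
    if "c \<in> Obj (base P)" for c
    using hom[OF that] by (auto elim!: Hom_EM_E)
  interpret \<psi>: nat_trans "base P" "base T" "endo T \<circ>\<^sub>F B" "B \<circ>\<^sub>F endo P" \<psi>
  proof
    fix f a b assume f: "f \<in> Hom (base P) a b"
    have ab: "a \<in> Obj (base P)" "b \<in> Obj (base P)" using f by (auto dest: endo.dom_cat.Obj_of_Hom)
    show "amap (B \<circ>\<^sub>F endo P) f \<cdot>\<^bsub>base T\<^esub> \<psi> a = \<psi> b \<cdot>\<^bsub>base T\<^esub> amap (endo T \<circ>\<^sub>F B) f"
      using \<Lambda>.naturality[OF f] f ab
      by (simp add: HomD amap_lift cmp_free_amap trans_lift)
  qed (simp add: Hom_def \<psi>)
  show ?thesis
  proof
    fix c assume c: "c \<in> Obj (base P)"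
    let ?Pc = "omap (endo P) c"
    show "\<psi> c \<cdot>\<^bsub>base T\<^esub> mult T (omap B c)
        = amap B (mult P c) \<cdot>\<^bsub>base T\<^esub> (\<psi> ?Pc \<cdot>\<^bsub>base T\<^esub> amap (endo T) (\<psi> c))"
      using c mult[OF c] by (simp add: \<psi>)
    \<comment> \<open>This identity is inserted in front of \<open>\<psi> c\<close> after the unit.
      Naturality of \<open>\<psi>\<close> at \<open>unit P c\<close>, then of \<open>unit T\<close>,
      moves the unit of \<open>P\<close> to the right, until the unit law of the lifted free algebra
      cancels everything else.\<close>
    have "amap B (mult P c) \<cdot>\<^bsub>base T\<^esub> amap B (amap (endo P) (unit P c)) = Ide (base T) (omap B ?Pc)"
      using c mult_unit_right[OF c] by (simp flip: B.amap_Cmp)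
    then have "\<psi> c \<cdot>\<^bsub>base T\<^esub> unit T (omap B c)
        = (amap B (mult P c) \<cdot>\<^bsub>base T\<^esub> amap B (amap (endo P) (unit P c)))
          \<cdot>\<^bsub>base T\<^esub> (\<psi> c \<cdot>\<^bsub>base T\<^esub> unit T (omap B c))"
      using c by (simp add: \<psi>)
    also have "\<dots> = amap B (mult P c) \<cdot>\<^bsub>base T\<^esub>
        ((amap B (amap (endo P) (unit P c)) \<cdot>\<^bsub>base T\<^esub> \<psi> c) \<cdot>\<^bsub>base T\<^esub> unit T (omap B c))"
      using c by (simp add: \<psi>)
    also have "amap B (amap (endo P) (unit P c)) \<cdot>\<^bsub>base T\<^esub> \<psi> c
        = \<psi> ?Pc \<cdot>\<^bsub>base T\<^esub> amap (endo T) (amap B (unit P c))"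
      using c \<psi>.naturality_Arr[of "unit P c"] by simp
    also have "amap B (mult P c) \<cdot>\<^bsub>base T\<^esub>
        ((\<psi> ?Pc \<cdot>\<^bsub>base T\<^esub> amap (endo T) (amap B (unit P c))) \<cdot>\<^bsub>base T\<^esub> unit T (omap B c))
        = amap B (mult P c) \<cdot>\<^bsub>base T\<^esub>
        (\<psi> ?Pc \<cdot>\<^bsub>base T\<^esub> (amap (endo T) (amap B (unit P c)) \<cdot>\<^bsub>base T\<^esub> unit T (omap B c)))"
      using c by (simp add: \<psi>)
    also have "amap (endo T) (amap B (unit P c)) \<cdot>\<^bsub>base T\<^esub> unit T (omap B c)
        = unit T (omap B ?Pc) \<cdot>\<^bsub>base T\<^esub> amap B (unit P c)"
      using c T.unit.naturality_Arr[of "amap B (unit P c)"] by simp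
    also have "amap B (mult P c) \<cdot>\<^bsub>base T\<^esub>
        (\<psi> ?Pc \<cdot>\<^bsub>base T\<^esub> (unit T (omap B ?Pc) \<cdot>\<^bsub>base T\<^esub> amap B (unit P c)))
        = ((amap B (mult P c) \<cdot>\<^bsub>base T\<^esub> \<psi> ?Pc) \<cdot>\<^bsub>base T\<^esub> unit T (omap B ?Pc)) \<cdot>\<^bsub>base T\<^esub> amap B (unit P c)"
      using c by (simp add: \<psi>)
    also have "(amap B (mult P c) \<cdot>\<^bsub>base T\<^esub> \<psi> ?Pc) \<cdot>\<^bsub>base T\<^esub> unit T (omap B ?Pc)
        = Ide (base T) (omap B ?Pc)"
      using algebra_simps_EM(5)[OF alg[OF c]] by simp
    finally show "\<psi> c \<cdot>\<^bsub>base T\<^esub> unit T (omap B c) = amap B (unit P c)"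
      using c by simp
  qed
qed

lemma adjR_1cell_lift_iff:
  "is_monad T \<Longrightarrow> adjR_1cell A (EM_adj T) (B, V, \<Lambda>) \<longleftrightarrow> mnd_1cell P T (B, \<psi>)"
  unfolding mnd_1cell_iff is_monad_iff
  using adjR_1cell_of_monad_cell monad_cell_of_adjR_1cell by blast

end

end

section \<open>Products with a parameter category\<close>

lemma prod_mnd_sel [simp]:
  "base (S \<times>\<^sub>M E) = base S \<times>\<^sub>C base E" "endo (S \<times>\<^sub>M E) = endo S \<times>\<^sub>F endo E"
  "mult (S \<times>\<^sub>M E) = map_prod (mult S) (mult E)" "unit (S \<times>\<^sub>M E) = map_prod (unit S) (unit E)"
  by (simp_all add: prod_mnd_def)

lemma id_mnd_sel [simp]:
  "base (id_mnd Q) = Q" "endo (id_mnd Q) = id_ftr" "mult (id_mnd Q) = Ide Q" "unit (id_mnd Q) = Ide Q"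
  by (simp_all add: id_mnd_def)

lemma EM_prod_sel [simp]:
  "omap EM_prod p = ((fst (fst p), fst (snd p)), (snd (fst p), snd (snd p)))"
  "amap EM_prod h = (omap EM_prod (fst (fst h), fst (snd h)), (fst (snd (fst h)), fst (snd (snd h))),
     omap EM_prod (snd (snd (fst h)), snd (snd (snd h))))"
  by (simp_all add: EM_prod_def split: prod.splits)

lemma EM_triv_sel [simp]:
  "omap (EM_triv Q) q = (q, Ide Q q)"
  "amap (EM_triv Q) r = (omap (EM_triv Q) (Dom Q r), r, omap (EM_triv Q) (Cod Q r))"
  by (simp_all add: EM_triv_def)

lemma monad_id_mnd:
  assumes "category Q"
  shows "monad (id_mnd Q)"
proof -
  interpret category Q by fact
  show ?thesis
    unfolding monad_def monad_axioms_def id_mnd_sel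
    using assms
    by (intro conjI allI impI nat_trans_Ide functor_comp[OF functor_id functor_id] functor_id)
      simp_all
qed

lemma monad_prod:
  assumes "monad S" "monad E"
  shows "monad (S \<times>\<^sub>M E)"
proof -
  interpret S: monad S by fact
  interpret E: monad E by fact
  show ?thesis
    unfolding monad_def monad_axioms_def prod_mnd_sel
    by (intro conjI functor_prod S.endo.cat_functor_axioms E.endo.cat_functor_axioms
          nat_trans_prod[OF S.mult.nat_trans_axioms E.mult.nat_trans_axioms]
          nat_trans_prod[OF S.unit.nat_trans_axioms E.unit.nat_trans_axioms])
      (auto intro!: ftr_eqI simp: S.mult_assoc E.mult_assoc S.mult_unit_left E.mult_unit_left
        S.mult_unit_right E.mult_unit_right)
qed

text \<open>The case without parameter, for cells at a fixed parameter.\<close>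

lemma (in monad) em_comparison_EM: "em_comparison S (EM_adj S) id_ftr"
  by (intro em_comparison.intro monad_axioms em_comparison_axioms.intro)
    (use adj_0cell_EM functor_id[OF category_EM] in \<open>auto simp: adj_0cell_def\<close>)

text \<open>The comparison turns \<open>((m, k), q)\<close> into the algebra on
  \<open>(m, q)\<close> with structure map \<open>(k, Ide Q q)\<close>. In the second coordinate
  every law is an identity law of \<open>Q\<close>; in the first it is a law for
  \<open>S\<close>.\<close>

lemma em_comparison_right:
  assumes "monad S" "category Q"
  shows "em_comparison (S \<times>\<^sub>M id_mnd Q) (EM_adj S \<times>\<^sub>A id_adj Q) (EM_prod \<circ>\<^sub>F id_ftr \<times>\<^sub>F EM_triv Q)"
    (is "em_comparison ?P ?A ?N")
proof -
  interpret S: monad S by fact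
  interpret Q: category Q by fact
  interpret P: monad ?P by (rule monad_prod[OF assms(1) monad_id_mnd[OF assms(2)]])
  interpret EP: category "EM ?P" by (rule P.category_EM)
  interpret SQ: category "EM S \<times>\<^sub>C Q" by (rule category_prod[OF S.category_EM assms(2)])
  have alg: "omap ?N p \<in> algebras ?P" if "fst p \<in> algebras S" "snd p \<in> Obj Q" for p
    unfolding algebras_iff using that by (simp add: algebra_mult)
  have N: "cat_functor (EM S \<times>\<^sub>C Q) (EM ?P) ?N"
  proof
    fix p assume "p \<in> Obj (EM S \<times>\<^sub>C Q)"
    then have p: "fst p \<in> algebras S" "snd p \<in> Obj Q" by auto
    show "omap ?N p \<in> Obj (EM ?P)" using alg[OF p] by simp
    show "amap ?N (Ide (EM S \<times>\<^sub>C Q) p) = Ide (EM ?P) (omap ?N p)" using p by simp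
  next
    fix h p p' assume "h \<in> Hom (EM S \<times>\<^sub>C Q) p p'"
    then have "fst h \<in> Hom (EM S) (fst p) (fst p')" and r: "snd h \<in> Hom Q (snd p) (snd p')" by auto
    then obtain f where h: "fst h = (fst p, f, fst p')"
      and f: "fst p \<in> algebras S" "fst p' \<in> algebras S" "f \<in> Arr (base S)"
        "Dom (base S) f = fst (fst p)" "Cod (base S) f = fst (fst p')"
        "f \<cdot>\<^bsub>base S\<^esub> snd (fst p) = snd (fst p') \<cdot>\<^bsub>base S\<^esub> amap (endo S) f"
      by (auto elim!: Hom_EM_E)
    have "(omap ?N p, (f, snd h), omap ?N p') \<in> Hom (EM ?P) (omap ?N p) (omap ?N p')"
      using f r Q.Obj_of_Hom[OF r] by (intro Hom_EM_I alg) (simp_all add: HomD)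
    then show "amap ?N h \<in> Hom (EM ?P) (omap ?N p) (omap ?N p')"
      using r by (simp add: h HomD)
  next
    fix h h' p p' p'' assume "h \<in> Hom (EM S \<times>\<^sub>C Q) p p'" "h' \<in> Hom (EM S \<times>\<^sub>C Q) p' p''"
    then have "fst h \<in> Hom (EM S) (fst p) (fst p')" "snd h \<in> Hom Q (snd p) (snd p')"
      "fst h' \<in> Hom (EM S) (fst p') (fst p'')" "snd h' \<in> Hom Q (snd p') (snd p'')" by auto
    then show "amap ?N (h' \<cdot>\<^bsub>EM S \<times>\<^sub>C Q\<^esub> h) = amap ?N h' \<cdot>\<^bsub>EM ?P\<^esub> amap ?N h"
      by (auto simp: HomD elim!: Hom_EM_E)
  qed
  show ?thesis
    by (intro em_comparison.intro P.monad_axioms em_comparison_axioms.intro)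
      (use N adj_0cell_prod[OF S.adj_0cell_EM adj_0cell_id[OF assms(2)]] in
        \<open>auto simp: adj_0cell_def\<close>)
qed

text \<open>Mirror image of \<open>em_comparison_right\<close>, to be applied to the opposite of the
  parameter category.\<close>

lemma em_comparison_left:
  assumes "category Q" "monad T"
  shows "em_comparison (id_mnd Q \<times>\<^sub>M T) (id_adj Q \<times>\<^sub>A EM_adj T) (EM_prod \<circ>\<^sub>F EM_triv Q \<times>\<^sub>F id_ftr)"
    (is "em_comparison ?P ?A ?N")
proof -
  interpret T: monad T by fact
  interpret Q: category Q by fact
  interpret P: monad ?P by (rule monad_prod[OF monad_id_mnd[OF assms(1)] assms(2)])
  interpret EP: category "EM ?P" by (rule P.category_EM)
  interpret QT: category "Q \<times>\<^sub>C EM T" by (rule category_prod[OF assms(1) T.category_EM])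
  have alg: "omap ?N p \<in> algebras ?P" if "fst p \<in> Obj Q" "snd p \<in> algebras T" for p
    unfolding algebras_iff using that by (simp add: algebra_mult)
  have N: "cat_functor (Q \<times>\<^sub>C EM T) (EM ?P) ?N"
  proof
    fix p assume "p \<in> Obj (Q \<times>\<^sub>C EM T)"
    then have p: "fst p \<in> Obj Q" "snd p \<in> algebras T" by auto
    show "omap ?N p \<in> Obj (EM ?P)" using alg[OF p] by simp
    show "amap ?N (Ide (Q \<times>\<^sub>C EM T) p) = Ide (EM ?P) (omap ?N p)" using p by simp
  next
    fix h p p' assume "h \<in> Hom (Q \<times>\<^sub>C EM T) p p'"
    then have "snd h \<in> Hom (EM T) (snd p) (snd p')" and r: "fst h \<in> Hom Q (fst p) (fst p')" by auto
    then obtain f where h: "snd h = (snd p, f, snd p')"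
      and f: "snd p \<in> algebras T" "snd p' \<in> algebras T" "f \<in> Arr (base T)"
        "Dom (base T) f = fst (snd p)" "Cod (base T) f = fst (snd p')"
        "f \<cdot>\<^bsub>base T\<^esub> snd (snd p) = snd (snd p') \<cdot>\<^bsub>base T\<^esub> amap (endo T) f"
      by (auto elim!: Hom_EM_E)
    have "(omap ?N p, (fst h, f), omap ?N p') \<in> Hom (EM ?P) (omap ?N p) (omap ?N p')"
      using f r Q.Obj_of_Hom[OF r] by (intro Hom_EM_I alg) (simp_all add: HomD)
    then show "amap ?N h \<in> Hom (EM ?P) (omap ?N p) (omap ?N p')"
      using r by (simp add: h HomD)
  next
    fix h h' p p' p'' assume "h \<in> Hom (Q \<times>\<^sub>C EM T) p p'" "h' \<in> Hom (Q \<times>\<^sub>C EM T) p' p''"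
    then have "snd h \<in> Hom (EM T) (snd p) (snd p')" "fst h \<in> Hom Q (fst p) (fst p')"
      "snd h' \<in> Hom (EM T) (snd p') (snd p'')" "fst h' \<in> Hom Q (fst p') (fst p'')" by auto
    then show "amap ?N (h' \<cdot>\<^bsub>Q \<times>\<^sub>C EM T\<^esub> h) = amap ?N h' \<cdot>\<^bsub>EM ?P\<^esub> amap ?N h"
      by (auto simp: HomD elim!: Hom_EM_E)
  qed
  show ?thesis
    by (intro em_comparison.intro P.monad_axioms em_comparison_axioms.intro)
      (use N adj_0cell_prod[OF adj_0cell_id[OF assms(1)] T.adj_0cell_EM] in
        \<open>auto simp: adj_0cell_def\<close>)
qed

section \<open>2-cells and adjoint objects\<close>

text \<open>Weaker than equality with the lifting: lifting the identity, for example, composes a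
  structure map with an identity arrow, which has no effect only if the structure map really is an
  arrow of the right source.\<close>

definition lift_of ::
    "('o, 'a) mnd \<Rightarrow> ('p, 'b) mnd \<Rightarrow> ('o, 'a, 'p, 'b) mnd_cell
      \<Rightarrow> (('o, 'a) em_obj, ('o, 'a) em_arr, ('p, 'b) em_obj, ('p, 'b) em_arr) ftr
      \<Rightarrow> ('o \<Rightarrow> ('p, 'b) em_arr) \<Rightarrow> bool" where
  "lift_of S T cell V \<Lambda> \<longleftrightarrow>
     (\<forall>x \<in> algebras S. omap V x = omap (lift_ftr T cell) x)
     \<and> (\<forall>h \<in> Arr (EM S). amap V h = amap (lift_ftr T cell) h)
     \<and> (\<forall>c \<in> Obj (base S). \<Lambda> c = lift_trans S T cell c)"

lemma lift_of_1cell_iff: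
  assumes "is_monad S" "is_monad T" "lift_of S T (B, \<psi>) V \<Lambda>"
  shows "adjR_1cell (EM_adj S) (EM_adj T) (B, V, \<Lambda>) \<longleftrightarrow> mnd_1cell S T (B, \<psi>)"
  using assms
  by (intro em_comparison.adjR_1cell_lift_iff[OF monad.em_comparison_EM])
    (simp_all add: is_monad_iff lift_of_def)

lemma lift_of_lift: "lift_of S T (B, \<psi>) (lift_ftr T (B, \<psi>)) (lift_trans S T (B, \<psi>))"
  by (simp add: lift_of_def)

lemma (in monad) lift_of_id:
  "lift_of S S (mnd_id S) id_ftr (\<lambda>c. Ide (EM S) (omap (EM_free S) c))"
proof -
  have "amap id_ftr h = amap (lift_ftr S (mnd_id S)) h" if "h \<in> Arr (EM S)" for h
  proof -
    have "h \<in> Hom (EM S) (fst h) (snd (snd h))" using that by (simp add: Hom_def)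
    then show ?thesis by (rule Hom_EM_E) (simp add: mnd_id_def prod_eq_iff)
  qed
  then show ?thesis by (simp add: lift_of_def mnd_id_def)
qed

text \<open>Functoriality of \<open>K\<close> splits its value on the structure map lifted along
  \<open>J\<close>; what then stands behind the image of the original structure map is the
  transformation of the composite cell.\<close>

lemma lift_of_comp:
  assumes "monad_cell S T J \<psi>J" "monad_cell T U K \<psi>K"
  shows "lift_of S U (mnd_comp U (K, \<psi>K) (J, \<psi>J)) (lift_ftr U (K, \<psi>K) \<circ>\<^sub>F lift_ftr T (J, \<psi>J))
    (\<lambda>c. amap (lift_ftr U (K, \<psi>K)) (lift_trans S T (J, \<psi>J) c)
      \<cdot>\<^bsub>EM U\<^esub> lift_trans T U (K, \<psi>K) (omap J c))"
proof -
  interpret J: monad_cell S T J \<psi>J by fact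
  interpret K: monad_cell T U K \<psi>K by fact
  have obj: "omap (lift_ftr U (K, \<psi>K)) (omap (lift_ftr T (J, \<psi>J)) x)
      = omap (lift_ftr U (mnd_comp U (K, \<psi>K) (J, \<psi>J))) x" if "x \<in> algebras S" for x
    using that by (simp add: K.func.amap_Cmp)
  have arr: "amap (lift_ftr U (K, \<psi>K) \<circ>\<^sub>F lift_ftr T (J, \<psi>J)) h
      = amap (lift_ftr U (mnd_comp U (K, \<psi>K) (J, \<psi>J))) h" if "h \<in> Arr (EM S)" for h
  proof -
    have "h \<in> Hom (EM S) (fst h) (snd (snd h))" using that by (simp add: Hom_def)
    then have "fst h \<in> algebras S" "snd (snd h) \<in> algebras S" by (auto elim: Hom_EM_E)
    then show ?thesis using obj[of "fst h"] obj[of "snd (snd h)"] by simp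
  qed
  show ?thesis
    unfolding lift_of_def
    using obj arr J.source.free_algebra by (auto simp: K.func.amap_Cmp)
qed

section \<open>Correspondence of 2-cells\<close>

lemma mnd_2cell_of_adjR_2cell:
  assumes "is_monad S" "is_monad T"
    and A: "lift_of S T (A, \<psi>A) V \<Lambda>" and B: "lift_of S T (B, \<psi>B) V' \<Lambda>'"
    and cell: "adjR_2cell (EM_adj S) (EM_adj T) (A, V, \<Lambda>) (B, V', \<Lambda>') \<alpha> \<beta>"
  shows "mnd_2cell S T (A, \<psi>A) (B, \<psi>B) \<alpha>"
    and "\<And>x. x \<in> algebras S \<Longrightarrow> \<beta> x = (omap V x, \<alpha> (fst x), omap V' x)"
proof -
  have cells: "mnd_1cell S T (A, \<psi>A)" "mnd_1cell S T (B, \<psi>B)"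
    using cell lift_of_1cell_iff[OF assms(1,2) A] lift_of_1cell_iff[OF assms(1,2) B]
    by (simp_all del: adjR_1cell.simps mnd_1cell.simps)
  interpret A: monad_cell S T A \<psi>A using cells(1) by (simp add: mnd_1cell_iff del: mnd_1cell.simps)
  interpret B: monad_cell S T B \<psi>B using cells(2) by (simp add: mnd_1cell_iff del: mnd_1cell.simps)
  interpret \<alpha>: nat_trans "base S" "base T" A B \<alpha> using cell by simp
  interpret \<beta>: nat_trans "EM S" "EM T" V V' \<beta> using cell by (simp del: adjR_1cell.simps)
  define b where "b x = fst (snd (\<beta> x))" for x
  have b: "\<beta> x = (omap V x, b x, omap V' x)" "b x \<in> Arr (base T)"
    "Dom (base T) (b x) = omap A (fst x)" "Cod (base T) (b x) = omap B (fst x)"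
    if "x \<in> algebras S" for x
  proof -
    have "\<beta> x \<in> Hom (EM T) (omap V x) (omap V' x)" using \<beta>.component[of x] that by simp
    then show "\<beta> x = (omap V x, b x, omap V' x)" "b x \<in> Arr (base T)"
      "Dom (base T) (b x) = omap A (fst x)" "Cod (base T) (b x) = omap B (fst x)"
      using A B that by (auto simp: b_def lift_of_def elim!: Hom_EM_E)
  qed
  \<comment> \<open>The compatibility condition, read on underlying arrows. It becomes the monad
    2-cell law as soon as \<open>b\<close> is known to be \<open>\<alpha>\<close> at free
    algebras.\<close>
  have compat: "b (omap (EM_free S) c) \<cdot>\<^bsub>base T\<^esub> \<psi>A c = \<psi>B c \<cdot>\<^bsub>base T\<^esub> amap (endo T) (\<alpha> c)"
    if c: "c \<in> Obj (base S)" for c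
  proof -
    have "\<beta> (omap (EM_free S) c) \<cdot>\<^bsub>EM T\<^esub> \<Lambda> c = \<Lambda>' c \<cdot>\<^bsub>EM T\<^esub> amap (EM_free T) (\<alpha> c)"
      using cell c by (simp del: EM_sel EM_free_sel adjR_1cell.simps)
    then show ?thesis
      using A B c b(1)[OF A.source.free_algebra[OF c]] by (simp add: lift_of_def)
  qed
  have b_eq: "b x = \<alpha> (fst x)" if x: "x \<in> algebras S" for x
  proof -
    let ?m = "fst x" and ?k = "snd x" and ?F = "omap (EM_free S) (fst x)"
    have F: "?F \<in> algebras S" using A.source.free_algebra[of ?m] x by simp
    \<comment> \<open>The counit at \<open>x\<close>; naturality of \<open>\<beta>\<close> along it
      links \<open>b x\<close> to the value at the free algebra.\<close>
    have h: "(?F, ?k, x) \<in> Hom (EM S) ?F x"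
      using x F by (intro Hom_EM_I) (simp_all add: algebra_mult)
    have nat: "amap B ?k \<cdot>\<^bsub>base T\<^esub> b ?F = b x \<cdot>\<^bsub>base T\<^esub> amap A ?k"
      using \<beta>.naturality[OF h] Hom_Arr[OF h] A B x b(1)[OF x] b(1)[OF F] by (simp add: lift_of_def)
    \<comment> \<open>The splitting of the counit: \<open>?k\<close> after the unit is an identity,
      inserted here under \<open>A\<close> and cancelled at the end under \<open>B\<close>, once
      \<open>compat\<close> has replaced \<open>b\<close> by \<open>\<alpha>\<close>.\<close>
    have "b x = b x \<cdot>\<^bsub>base T\<^esub> amap A (?k \<cdot>\<^bsub>base S\<^esub> unit S ?m)"
      using x b[OF x] by simp
    also have "\<dots> = (b x \<cdot>\<^bsub>base T\<^esub> amap A ?k) \<cdot>\<^bsub>base T\<^esub> (\<psi>A ?m \<cdot>\<^bsub>base T\<^esub> unit T (omap A ?m))"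
      using x b(2-4)[OF x] by (simp add: A.func.amap_Cmp A.cell_unit del: algebra_simps_EM(5))
    also have "\<dots> = amap B ?k \<cdot>\<^bsub>base T\<^esub> ((b ?F \<cdot>\<^bsub>base T\<^esub> \<psi>A ?m) \<cdot>\<^bsub>base T\<^esub> unit T (omap A ?m))"
      unfolding nat[symmetric] using x b(2-4)[OF F] by simp
    also have "(b ?F \<cdot>\<^bsub>base T\<^esub> \<psi>A ?m) \<cdot>\<^bsub>base T\<^esub> unit T (omap A ?m)
        = \<psi>B ?m \<cdot>\<^bsub>base T\<^esub> (amap (endo T) (\<alpha> ?m) \<cdot>\<^bsub>base T\<^esub> unit T (omap A ?m))"
      using x compat[of ?m] by simp
    also have "amap (endo T) (\<alpha> ?m) \<cdot>\<^bsub>base T\<^esub> unit T (omap A ?m)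
        = unit T (omap B ?m) \<cdot>\<^bsub>base T\<^esub> \<alpha> ?m"
      using x A.target.unit.naturality_Arr[of "\<alpha> ?m"] by simp
    also have "amap B ?k \<cdot>\<^bsub>base T\<^esub> (\<psi>B ?m \<cdot>\<^bsub>base T\<^esub> (unit T (omap B ?m) \<cdot>\<^bsub>base T\<^esub> \<alpha> ?m))
        = amap B ?k \<cdot>\<^bsub>base T\<^esub> ((\<psi>B ?m \<cdot>\<^bsub>base T\<^esub> unit T (omap B ?m)) \<cdot>\<^bsub>base T\<^esub> \<alpha> ?m)"
      using x by simp
    also have "\<dots> = amap B (?k \<cdot>\<^bsub>base S\<^esub> unit S ?m) \<cdot>\<^bsub>base T\<^esub> \<alpha> ?m"
      using x by (simp add: B.cell_unit B.func.amap_Cmp del: algebra_simps_EM(5))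
    also have "\<dots> = \<alpha> ?m" using x by simp
    finally show ?thesis .
  qed
  show "\<beta> x = (omap V x, \<alpha> (fst x), omap V' x)" if "x \<in> algebras S" for x
    using b(1)[OF that] b_eq[OF that] by simp
  have "\<psi>B c \<cdot>\<^bsub>base T\<^esub> amap (endo T) (\<alpha> c) = \<alpha> (omap (endo S) c) \<cdot>\<^bsub>base T\<^esub> \<psi>A c"
    if "c \<in> Obj (base S)" for c
    using compat[OF that] b_eq[OF A.source.free_algebra[OF that]] by simp
  then show "mnd_2cell S T (A, \<psi>A) (B, \<psi>B) \<alpha>"
    using cells \<alpha>.nat_trans_axioms by (simp del: mnd_1cell.simps)
qed

text \<open>The morphism square of \<open>\<beta> x\<close> is naturality of \<open>\<alpha>\<close>
  at the structure map pasted with the monad 2-cell law; compatibility with \<open>\<Lambda>\<close>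
  and \<open>\<Lambda>'\<close> is that law itself.\<close>

lemma adjR_2cell_of_mnd_2cell:
  assumes "is_monad S" "is_monad T"
    and A: "lift_of S T (A, \<psi>A) V \<Lambda>" and B: "lift_of S T (B, \<psi>B) V' \<Lambda>'"
    and cell: "mnd_2cell S T (A, \<psi>A) (B, \<psi>B) \<alpha>"
    and \<beta>: "\<And>x. x \<in> algebras S \<Longrightarrow> \<beta> x = (omap V x, \<alpha> (fst x), omap V' x)"
  shows "adjR_2cell (EM_adj S) (EM_adj T) (A, V, \<Lambda>) (B, V', \<Lambda>') \<alpha> \<beta>"
proof -
  have cells: "adjR_1cell (EM_adj S) (EM_adj T) (A, V, \<Lambda>)"
    "adjR_1cell (EM_adj S) (EM_adj T) (B, V', \<Lambda>')"
    using cell lift_of_1cell_iff[OF assms(1,2) A] lift_of_1cell_iff[OF assms(1,2) B]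
    by (simp_all del: adjR_1cell.simps mnd_1cell.simps)
  interpret A: monad_cell S T A \<psi>A using cell by (simp add: mnd_1cell_iff del: mnd_1cell.simps)
  interpret B: monad_cell S T B \<psi>B using cell by (simp add: mnd_1cell_iff del: mnd_1cell.simps)
  interpret \<alpha>: nat_trans "base S" "base T" A B \<alpha> using cell by simp
  interpret V: cat_functor "EM S" "EM T" V using cells(1) by simp
  interpret V': cat_functor "EM S" "EM T" V' using cells(2) by simp
  have compat: "\<psi>B c \<cdot>\<^bsub>base T\<^esub> amap (endo T) (\<alpha> c) = \<alpha> (omap (endo S) c) \<cdot>\<^bsub>base T\<^esub> \<psi>A c"
    if "c \<in> Obj (base S)" for c
    using cell that by simp
  have V: "omap V x = omap (lift_ftr T (A, \<psi>A)) x" and V': "omap V' x = omap (lift_ftr T (B, \<psi>B)) x"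
    if "x \<in> algebras S" for x
    using A B that by (simp_all only: lift_of_def)
  have "nat_trans (EM S) (EM T) V V' \<beta>"
  proof
    fix x assume "x \<in> Obj (EM S)"
    then have x: "x \<in> algebras S" by simp
    let ?m = "fst x" and ?k = "snd x"
    have "\<alpha> ?m \<cdot>\<^bsub>base T\<^esub> (amap A ?k \<cdot>\<^bsub>base T\<^esub> \<psi>A ?m) = (\<alpha> ?m \<cdot>\<^bsub>base T\<^esub> amap A ?k) \<cdot>\<^bsub>base T\<^esub> \<psi>A ?m"
      using x by simp
    also have "\<alpha> ?m \<cdot>\<^bsub>base T\<^esub> amap A ?k = amap B ?k \<cdot>\<^bsub>base T\<^esub> \<alpha> (omap (endo S) ?m)"
      using x \<alpha>.naturality_Arr[of ?k] by simp
    also have "\<dots> \<cdot>\<^bsub>base T\<^esub> \<psi>A ?m = (amap B ?k \<cdot>\<^bsub>base T\<^esub> \<psi>B ?m) \<cdot>\<^bsub>base T\<^esub> amap (endo T) (\<alpha> ?m)"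
      using x by (simp add: compat)
    finally have "(omap V x, \<alpha> ?m, omap V' x) \<in> Hom (EM T) (omap V x) (omap V' x)"
      using x V.omap_obj[of x] V'.omap_obj[of x] by (intro Hom_EM_I) (simp_all add: V V')
    then show "\<beta> x \<in> Hom (EM T) (omap V x) (omap V' x)" by (simp add: \<beta>[OF x])
  next
    fix h x y assume h: "h \<in> Hom (EM S) x y"
    then obtain f where f: "h = (x, f, y)" "x \<in> algebras S" "y \<in> algebras S" "f \<in> Arr (base S)"
      "Dom (base S) f = fst x" "Cod (base S) f = fst y"
      by (auto elim!: Hom_EM_E)
    show "amap V' h \<cdot>\<^bsub>EM T\<^esub> \<beta> x = \<beta> y \<cdot>\<^bsub>EM T\<^esub> amap V h"
      using Hom_Arr[OF h] A B f \<alpha>.naturality_Arr[of f] by (simp add: \<beta> lift_of_def)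
  qed
  moreover have "\<beta> (omap (EM_free S) c) \<cdot>\<^bsub>EM T\<^esub> \<Lambda> c = \<Lambda>' c \<cdot>\<^bsub>EM T\<^esub> amap (EM_free T) (\<alpha> c)"
    if c: "c \<in> Obj (base S)" for c
    using A B c \<beta>[OF A.source.free_algebra[OF c]] V'[OF A.source.free_algebra[OF c]]
    by (simp add: lift_of_def compat)
  ultimately show ?thesis
    using cells \<alpha>.nat_trans_axioms by (simp del: adjR_1cell.simps EM_sel EM_free_sel)
qed

section \<open>Correspondence of adjoint objects\<close>

text \<open>From left to right the 2-cell correspondence forces the form of \<open>\<eta>'\<close>
  and \<open>\<epsilon>'\<close>. From right to left it produces the 2-cells, and the lifted
  triangle identities have those of \<open>J\<close> and \<open>K\<close> as underlying
  equations.\<close>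

lemma adjR_adjoint_object_lift_iff:
  assumes "is_monad S" "is_monad T"
  shows "adjR_adjoint_object (EM_adj S) (EM_adj T)
      (J, lift_ftr T (J, \<psi>J), lift_trans S T (J, \<psi>J)) (K, lift_ftr S (K, \<psi>K), lift_trans T S (K, \<psi>K))
      (\<eta>, \<epsilon>) (\<eta>', \<epsilon>')
    \<longleftrightarrow> mnd_adjoint_object S T (J, \<psi>J) (K, \<psi>K) (\<eta>, \<epsilon>)
      \<and> (\<forall>x \<in> algebras S. \<eta>' x
          = (x, \<eta> (fst x), omap (lift_ftr S (K, \<psi>K)) (omap (lift_ftr T (J, \<psi>J)) x)))
      \<and> (\<forall>y \<in> algebras T. \<epsilon>' y
          = (omap (lift_ftr T (J, \<psi>J)) (omap (lift_ftr S (K, \<psi>K)) y), \<epsilon> (fst y), y))"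
    (is "?adj \<longleftrightarrow> ?mnd \<and> ?\<eta>' \<and> ?\<epsilon>'")
proof -
  let ?V = "lift_ftr T (J, \<psi>J)" and ?W = "lift_ftr S (K, \<psi>K)"
  have J: "adjR_1cell (EM_adj S) (EM_adj T) (J, ?V, lift_trans S T (J, \<psi>J)) \<longleftrightarrow> mnd_1cell S T (J, \<psi>J)"
    and K: "adjR_1cell (EM_adj T) (EM_adj S) (K, ?W, lift_trans T S (K, \<psi>K)) \<longleftrightarrow> mnd_1cell T S (K, \<psi>K)"
    using assms by (intro lift_of_1cell_iff lift_of_lift; simp)+
  have idS: "lift_of S S (id_ftr, \<lambda>c. Ide (base S) (omap (endo S) c)) id_ftr
      (\<lambda>c. Ide (EM S) (omap (EM_free S) c))"
    and idT: "lift_of T T (id_ftr, \<lambda>c. Ide (base T) (omap (endo T) c)) id_ftr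
      (\<lambda>c. Ide (EM T) (omap (EM_free T) c))"
    using assms monad.lift_of_id[of S] monad.lift_of_id[of T] by (simp_all add: is_monad_iff mnd_id_def)
  have comps:
    "lift_of S S (K \<circ>\<^sub>F J, \<lambda>c. amap K (\<psi>J c) \<cdot>\<^bsub>base S\<^esub> \<psi>K (omap J c)) (?W \<circ>\<^sub>F ?V)
      (\<lambda>c. amap ?W (lift_trans S T (J, \<psi>J) c) \<cdot>\<^bsub>EM S\<^esub> lift_trans T S (K, \<psi>K) (omap J c))"
    "lift_of T T (J \<circ>\<^sub>F K, \<lambda>c. amap J (\<psi>K c) \<cdot>\<^bsub>base T\<^esub> \<psi>J (omap K c)) (?V \<circ>\<^sub>F ?W)
      (\<lambda>c. amap ?V (lift_trans T S (K, \<psi>K) c) \<cdot>\<^bsub>EM T\<^esub> lift_trans S T (J, \<psi>J) (omap K c))"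
    if "mnd_1cell S T (J, \<psi>J)" "mnd_1cell T S (K, \<psi>K)"
    using lift_of_comp[of S T J \<psi>J S K \<psi>K] lift_of_comp[of T S K \<psi>K T J \<psi>J] that
    by (simp_all only: mnd_1cell_iff mnd_comp.simps)
  show ?thesis
  proof
    assume adj: ?adj
    then have cells: "mnd_1cell S T (J, \<psi>J)" "mnd_1cell T S (K, \<psi>K)"
      and adjunction: "adjunction (base S) (base T) J K \<eta> \<epsilon>"
      and unit: "adjR_2cell (EM_adj S) (EM_adj S) (adjR_id (EM_adj S))
        (adjR_comp (EM_adj S) (K, ?W, lift_trans T S (K, \<psi>K)) (J, ?V, lift_trans S T (J, \<psi>J))) \<eta> \<eta>'"
      and counit: "adjR_2cell (EM_adj T) (EM_adj T)
        (adjR_comp (EM_adj T) (J, ?V, lift_trans S T (J, \<psi>J)) (K, ?W, lift_trans T S (K, \<psi>K)))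
        (adjR_id (EM_adj T)) \<epsilon> \<epsilon>'"
      unfolding adjR_adjoint_object.simps J K EM_adj_sel by blast+
    note unit = mnd_2cell_of_adjR_2cell[OF assms(1,1) idS comps(1)[OF cells]
        unit[unfolded adjR_id_def adjR_comp.simps EM_adj_sel]]
    note counit = mnd_2cell_of_adjR_2cell[OF assms(2,2) comps(2)[OF cells] idT
        counit[unfolded adjR_id_def adjR_comp.simps EM_adj_sel]]
    have ?mnd
      unfolding mnd_adjoint_object.simps mnd_id_def mnd_comp.simps
      using cells adjunction unit(1) counit(1) by blast
    then show "?mnd \<and> ?\<eta>' \<and> ?\<epsilon>'"
      using unit(2) counit(2) by simp
  next
    assume rhs: "?mnd \<and> ?\<eta>' \<and> ?\<epsilon>'"
    then have cells: "mnd_1cell S T (J, \<psi>J)" "mnd_1cell T S (K, \<psi>K)"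
      and adjunction: "adjunction (base S) (base T) J K \<eta> \<epsilon>"
      and unit: "mnd_2cell S S (mnd_id S) (mnd_comp S (K, \<psi>K) (J, \<psi>J)) \<eta>"
      and counit: "mnd_2cell T T (mnd_comp T (J, \<psi>J) (K, \<psi>K)) (mnd_id T) \<epsilon>"
      by (simp_all only: mnd_adjoint_object.simps)
    have \<eta>': "\<eta>' x = (omap id_ftr x, \<eta> (fst x), omap (?W \<circ>\<^sub>F ?V) x)" if "x \<in> algebras S" for x
      using rhs that by simp
    have \<epsilon>': "\<epsilon>' y = (omap (?V \<circ>\<^sub>F ?W) y, \<epsilon> (fst y), omap id_ftr y)" if "y \<in> algebras T" for y
      using rhs that by simp
    have unit': "adjR_2cell (EM_adj S) (EM_adj S) (adjR_id (EM_adj S))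
        (adjR_comp (EM_adj S) (K, ?W, lift_trans T S (K, \<psi>K)) (J, ?V, lift_trans S T (J, \<psi>J))) \<eta> \<eta>'"
      unfolding adjR_id_def adjR_comp.simps EM_adj_sel
      by (rule adjR_2cell_of_mnd_2cell[OF assms(1,1) idS comps(1)[OF cells]
            unit[unfolded mnd_id_def mnd_comp.simps] \<eta>'])
    have counit': "adjR_2cell (EM_adj T) (EM_adj T)
        (adjR_comp (EM_adj T) (J, ?V, lift_trans S T (J, \<psi>J)) (K, ?W, lift_trans T S (K, \<psi>K)))
        (adjR_id (EM_adj T)) \<epsilon> \<epsilon>'"
      unfolding adjR_id_def adjR_comp.simps EM_adj_sel
      by (rule adjR_2cell_of_mnd_2cell[OF assms(2,2) comps(2)[OF cells] idT
            counit[unfolded mnd_id_def mnd_comp.simps] \<epsilon>'])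
    interpret J: monad_cell S T J \<psi>J using cells(1) by (simp only: mnd_1cell_iff)
    interpret K: monad_cell T S K \<psi>K using cells(2) by (simp only: mnd_1cell_iff)
    interpret V: cat_functor "EM S" "EM T" ?V by (rule J.functor_lift)
    interpret W: cat_functor "EM T" "EM S" ?W by (rule K.functor_lift)
    interpret adj: adjunction "base S" "base T" J K \<eta> \<epsilon> by (rule adjunction)
    have nat: "nat_trans (EM S) (EM S) id_ftr (?W \<circ>\<^sub>F ?V) \<eta>'" "nat_trans (EM T) (EM T) (?V \<circ>\<^sub>F ?W) id_ftr \<epsilon>'"
      using unit' counit'
      unfolding adjR_id_def adjR_comp.simps adjR_2cell.simps EM_adj_sel by blast+
    have "adjunction (EM S) (EM T) ?V ?W \<eta>' \<epsilon>'"
    proof (intro adjunction.intro nat V.cat_functor_axioms W.cat_functor_axioms adjunction_axioms.intro)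
      fix x assume "x \<in> Obj (EM S)"
      \<comment> \<open>The explicit forms of \<open>\<eta>'\<close> and \<open>\<epsilon>'\<close>
        are known at algebras only, so the lifted object must first be recognised as one.\<close>
      then have x: "x \<in> algebras S" and Vx: "omap ?V x \<in> algebras T"
        using V.omap_obj[of x] by (simp_all del: lift_ftr_sel)
      show "\<epsilon>' (omap ?V x) \<cdot>\<^bsub>EM T\<^esub> amap ?V (\<eta>' x) = Ide (EM T) (omap ?V x)"
        by (subst \<epsilon>'[OF Vx], subst \<eta>'[OF x]) (use x adj.triangle_left[of "fst x"] in simp)
    next
      fix y assume "y \<in> Obj (EM T)"
      then have y: "y \<in> algebras T" and Wy: "omap ?W y \<in> algebras S"
        using W.omap_obj[of y] by (simp_all del: lift_ftr_sel)
      show "amap ?W (\<epsilon>' y) \<cdot>\<^bsub>EM S\<^esub> \<eta>' (omap ?W y) = Ide (EM S) (omap ?W y)"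
        by (subst \<eta>'[OF Wy], subst \<epsilon>'[OF y]) (use y adj.triangle_right[of "fst y"] in simp)
    qed
    then show ?adj
      unfolding adjR_adjoint_object.simps J K EM_adj_sel
      using cells adjunction unit' counit' by blast
  qed
qed

section \<open>Parametric liftings\<close>

text \<open>\<open>EM_triv\<close> places an identity in the parameter slot of the structure map,
  which is just what \<open>fix_right\<close> does to arrows. Hence freezing the parameter commutes
  with lifting as an equality of records.\<close>

lemma fix_right_lift:
  assumes "category Q" "q \<in> Obj Q"
  shows "fix_right Q (lift_ftr_right Q T (A, \<psi>)) q = lift_ftr T (fix_right Q A q, \<lambda>c. \<psi> (c, q))"
  using assms
  by (intro ftr_eqI) (simp_all add: lift_ftr_right_def category.Ide_simps)

lemma fix_left_lift:
  assumes "category Q" "q \<in> Obj Q"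
  shows "fix_left Q (lift_ftr_left (op_cat Q) S (B, \<psi>)) q = lift_ftr S (fix_left Q B q, \<lambda>d. \<psi> (q, d))"
  using assms
  by (intro ftr_eqI) (simp_all add: lift_ftr_left_def category.Ide_simps)

lemma lift_trans_fix_right:
  "lift_trans (S \<times>\<^sub>M id_mnd Q) T (A, \<psi>) (c, q) = lift_trans S T (fix_right Q A q, \<lambda>c. \<psi> (c, q)) c"
  by simp

lemma lift_trans_fix_left:
  "lift_trans (id_mnd (op_cat Q) \<times>\<^sub>M T) S (B, \<psi>) (q, d)
    = lift_trans T S (fix_left Q B q, \<lambda>d. \<psi> (q, d)) d"
  by simp

section \<open>Parametric adjunctions between categories of algebras\<close>

text \<open>Faithfulness of the forgetful functor.\<close>

lemma EM_arr_eqI: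
  assumes "f \<in> Hom (EM S) x y" "g \<in> Hom (EM S) x y" "fst (snd f) = fst (snd g)"
  shows "f = g"
  using assms by (auto elim!: Hom_EM_E)

text \<open>The hypotheses place \<open>V\<close>, \<open>W\<close>, \<open>\<eta>'\<close> and
  \<open>\<epsilon>'\<close> over \<open>A\<close>, \<open>B\<close>, \<open>\<eta>\<close> and
  \<open>\<epsilon>\<close>. The law \<open>param\<close> then compares parallel arrows of algebras
  whose underlying arrows are the two sides of the law in the base, at \<open>fst y\<close>.\<close>

lemma param_adjunction_lift:
  fixes A :: "('o \<times> 'q, 'a \<times> 'r, 'd, 'b) ftr" and B :: "('q \<times> 'd, 'r \<times> 'b, 'o, 'a) ftr"
    and V :: "(('o, 'a) em_obj \<times> 'q, ('o, 'a) em_arr \<times> 'r, ('d, 'b) em_obj, ('d, 'b) em_arr) ftr"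
    and W :: "('q \<times> ('d, 'b) em_obj, 'r \<times> ('d, 'b) em_arr, ('o, 'a) em_obj, ('o, 'a) em_arr) ftr"
  assumes "param_adjunction (base S) Q (base T) A B \<eta> \<epsilon>"
    and V: "cat_functor (EM S \<times>\<^sub>C Q) (EM T) V" and W: "cat_functor (op_cat Q \<times>\<^sub>C EM T) (EM S) W"
    and adj: "\<And>q. q \<in> Obj Q \<Longrightarrow> adjunction (EM S) (EM T) (fix_right Q V q) (fix_left Q W q) (\<eta>' q) (\<epsilon>' q)"
    and V_arr: "\<And>h. fst (snd (amap V h)) = amap A (fst (snd (fst h)), snd h)"
    and W_obj: "\<And>p. fst (omap W p) = omap B (fst p, fst (snd p))"
    and W_arr: "\<And>h. fst (snd (amap W h)) = amap B (fst h, fst (snd (snd h)))"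
    and \<eta>': "\<And>q x. q \<in> Obj Q \<Longrightarrow> x \<in> algebras S \<Longrightarrow> fst (snd (\<eta>' q x)) = \<eta> q (fst x)"
    and \<epsilon>': "\<And>q y. q \<in> Obj Q \<Longrightarrow> y \<in> algebras T \<Longrightarrow> fst (snd (\<epsilon>' q y)) = \<epsilon> q (fst y)"
  shows "param_adjunction (EM S) Q (EM T) V W \<eta>' \<epsilon>'"
proof -
  interpret base: param_adjunction "base S" Q "base T" A B \<eta> \<epsilon> by fact
  interpret V: cat_functor "EM S \<times>\<^sub>C Q" "EM T" V by fact
  interpret W: cat_functor "op_cat Q \<times>\<^sub>C EM T" "EM S" W by fact
  show ?thesis
  proof (intro param_adjunction.intro base.category_axioms V W param_adjunction_axioms.intro adj)
    fix p q q' y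
    assume p: "p \<in> Hom Q q q'" and "y \<in> Obj (EM T)"
    then have y: "y \<in> algebras T" by simp
    have q: "q \<in> Obj Q" "q' \<in> Obj Q" using base.Obj_of_Hom[OF p] by auto
    interpret adj: adjunction "EM S" "EM T" "fix_right Q V q" "fix_left Q W q" "\<eta>' q" "\<epsilon>' q"
      by (rule adj[OF q(1)])
    interpret adj': adjunction "EM S" "EM T" "fix_right Q V q'" "fix_left Q W q'" "\<eta>' q'" "\<epsilon>' q'"
      by (rule adj[OF q(2)])
    have idy: "Ide (EM T) y \<in> Hom (EM T) y y" and Wy: "omap W (q', y) \<in> algebras S"
      using y V.cod_cat.ide_hom[of y] W.omap_obj[of "(q', y)"] q by simp_all
    \<comment> \<open>\<open>W\<close> is contravariant in the parameter, so an arrow from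
      \<open>q\<close> to \<open>q'\<close> acts from \<open>q'\<close> to \<open>q\<close>.
      Faithfulness requires both sides to be typed with these same endpoints.\<close>
    have lhs: "amap W (p, Ide (EM T) y) \<in> Hom (EM S) (omap W (q', y)) (omap W (q, y))"
      using W.amap_hom[of "(p, Ide (EM T) y)" "(q', y)" "(q, y)"] p idy by simp
    have "\<eta>' q (omap W (q', y))
        \<in> Hom (EM S) (omap W (q', y)) (omap W (q, omap V (omap W (q', y), q)))"
      using adj.unit.component[of "omap W (q', y)"] Wy by simp
    moreover have "amap V (Ide (EM S) (omap W (q', y)), p)
        \<in> Hom (EM T) (omap V (omap W (q', y), q)) (omap V (omap W (q', y), q'))"
      using V.amap_hom[of "(Ide (EM S) (omap W (q', y)), p)" "(omap W (q', y), q)" "(omap W (q', y), q')"]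
        p W.cod_cat.ide_hom[of "omap W (q', y)"] Wy by simp
    note adj.right.amap_hom[OF this]
    moreover have "\<epsilon>' q' y \<in> Hom (EM T) (omap V (omap W (q', y), q')) y"
      using adj'.counit.component[of y] y by simp
    note adj.right.amap_hom[OF this]
    ultimately have rhs: "amap (fix_left Q W q) (\<epsilon>' q' y)
        \<cdot>\<^bsub>EM S\<^esub> (amap (fix_left Q W q) (amap V (Ide (EM S) (omap W (q', y)), p))
        \<cdot>\<^bsub>EM S\<^esub> \<eta>' q (omap W (q', y))) \<in> Hom (EM S) (omap W (q', y)) (omap W (q, y))"
      by (auto intro!: W.cod_cat.cmp_hom simp del: EM_sel)
    show "amap W (p, Ide (EM T) y) = amap (fix_left Q W q) (\<epsilon>' q' y)
        \<cdot>\<^bsub>EM S\<^esub> (amap (fix_left Q W q) (amap V (Ide (EM S) (omap W (q', y)), p))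
        \<cdot>\<^bsub>EM S\<^esub> \<eta>' q (omap W (q', y)))"
      by (rule EM_arr_eqI[OF lhs rhs])
        (use base.param[OF p, of "fst y"] y q Wy in \<open>simp add: V_arr W_obj W_arr \<eta>' \<epsilon>'\<close>)
  qed
qed

text \<open>The set for adjunctions is the graph, over the set for monads, of the map that lifts
  units and counits; projecting a graph to its base is a bijection.\<close>

lemma bij_betw_hopf_param_adjunctions:
  fixes S :: "('o, 'a) mnd" and T :: "('d, 'b) mnd" and Q :: "('q, 'r) cat"
    and A :: "('o \<times> 'q, 'a \<times> 'r, 'd, 'b) ftr" and B :: "('q \<times> 'd, 'r \<times> 'b, 'o, 'a) ftr"
  assumes S: "is_monad S" and T: "is_monad T" and Q: "category Q"
  shows "bij_betw fst
    (hopf_param_adjunctions_AdjR (EM_adj S) (EM_adj T) Q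
      (A, lift_ftr_right Q T (A, \<psi>A), lift_trans (S \<times>\<^sub>M id_mnd Q) T (A, \<psi>A))
      (B, lift_ftr_left (op_cat Q) S (B, \<psi>B), lift_trans (id_mnd (op_cat Q) \<times>\<^sub>M T) S (B, \<psi>B)))
    (hopf_param_adjunctions_Mnd S T Q (A, \<psi>A) (B, \<psi>B))"
    (is "bij_betw fst ?Adj ?Mnd")
proof -
  let ?V = "lift_ftr_right Q T (A, \<psi>A)" and ?W = "lift_ftr_left (op_cat Q) S (B, \<psi>B)"
  let ?\<Lambda>A = "lift_trans (S \<times>\<^sub>M id_mnd Q) T (A, \<psi>A)"
    and ?\<Lambda>B = "lift_trans (id_mnd (op_cat Q) \<times>\<^sub>M T) S (B, \<psi>B)"
  define V where "V q = lift_ftr T (fix_right Q A q, \<lambda>c. \<psi>A (c, q))" for q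
  define W where "W q = lift_ftr S (fix_left Q B q, \<lambda>d. \<psi>B (q, d))" for q
  \<comment> \<open>The values are those forced by \<open>adjR_adjoint_object_lift_iff\<close>. The
    restricted abstractions give \<open>undefined\<close> off the objects, as
    \<open>component_families\<close> demands.\<close>
  define lift_unit where "lift_unit \<eta> =
    (\<lambda>q \<in> Obj Q. \<lambda>x \<in> algebras S. (x, \<eta> q (fst x), omap (W q) (omap (V q) x)))" for \<eta> :: "'q \<Rightarrow> 'o \<Rightarrow> 'a"
  define lift_counit where "lift_counit \<epsilon> =
    (\<lambda>q \<in> Obj Q. \<lambda>y \<in> algebras T. (omap (V q) (omap (W q) y), \<epsilon> q (fst y), y))" for \<epsilon> :: "'q \<Rightarrow> 'd \<Rightarrow> 'b"
  \<comment> \<open>Agreement with the lifting is immediate here: \<open>lift_ftr_right\<close> is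
    by definition the lifting after the comparison functor.\<close>
  have "adjR_1cell (EM_adj S \<times>\<^sub>A id_adj Q) (EM_adj T) (A, ?V, ?\<Lambda>A)
      \<longleftrightarrow> mnd_1cell (S \<times>\<^sub>M id_mnd Q) T (A, \<psi>A)"
    by (rule em_comparison.adjR_1cell_lift_iff[OF em_comparison_right])
      (use S T Q in \<open>simp_all only: is_monad_iff lift_ftr_right_def omap_comp_ftr amap_comp_ftr\<close>)
  note cellA = this
  have "adjR_1cell (id_adj (op_cat Q) \<times>\<^sub>A EM_adj T) (EM_adj S) (B, ?W, ?\<Lambda>B)
      \<longleftrightarrow> mnd_1cell (id_mnd (op_cat Q) \<times>\<^sub>M T) S (B, \<psi>B)"
    by (rule em_comparison.adjR_1cell_lift_iff[OF em_comparison_left])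
      (use S T category_op[OF Q] in
        \<open>simp_all only: is_monad_iff lift_ftr_left_def omap_comp_ftr amap_comp_ftr\<close>)
  note cellB = this
  have V: "fix_right Q ?V q = V q" and W: "fix_left Q ?W q = W q" if "q \<in> Obj Q" for q
    using fix_right_lift[OF Q that] fix_left_lift[OF Q that] by (simp_all only: V_def W_def)
  have adjoint_object: "adjR_adjoint_object (EM_adj S) (EM_adj T)
        (fix_right Q A q, fix_right Q ?V q, \<lambda>c. ?\<Lambda>A (c, q))
        (fix_left Q B q, fix_left Q ?W q, \<lambda>d. ?\<Lambda>B (q, d)) (\<eta> q, \<epsilon> q) (\<eta>' q, \<epsilon>' q)
      \<longleftrightarrow> mnd_adjoint_object S T (fix_right Q A q, \<lambda>c. \<psi>A (c, q)) (fix_left Q B q, \<lambda>d. \<psi>B (q, d))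
          (\<eta> q, \<epsilon> q)
        \<and> (\<forall>x \<in> algebras S. \<eta>' q x = (x, \<eta> q (fst x), omap (W q) (omap (V q) x)))
        \<and> (\<forall>y \<in> algebras T. \<epsilon>' q y = (omap (V q) (omap (W q) y), \<epsilon> q (fst y), y))"
    if "q \<in> Obj Q" for q \<eta> \<epsilon> \<eta>' \<epsilon>'
    unfolding fix_right_lift[OF Q that] fix_left_lift[OF Q that] lift_trans_fix_right lift_trans_fix_left
      V_def W_def
    by (rule adjR_adjoint_object_lift_iff[OF S T])
  \<comment> \<open>Pointwise conditions on objects plus normalisation elsewhere amount to equality
    of functions, so the lifted data are unique.\<close>
  have families_iff: "\<eta>' = lift_unit \<eta> \<longleftrightarrow> \<eta>' \<in> component_families Q (EM S)
      \<and> (\<forall>q \<in> Obj Q. \<forall>x \<in> algebras S. \<eta>' q x = (x, \<eta> q (fst x), omap (W q) (omap (V q) x)))"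
    "\<epsilon>' = lift_counit \<epsilon> \<longleftrightarrow> \<epsilon>' \<in> component_families Q (EM T)
      \<and> (\<forall>q \<in> Obj Q. \<forall>y \<in> algebras T. \<epsilon>' q y = (omap (V q) (omap (W q) y), \<epsilon> q (fst y), y))"
    for \<eta> \<epsilon> \<eta>' \<epsilon>'
    unfolding lift_unit_def lift_counit_def component_families_def
    by (auto simp: fun_eq_iff extensional_def)
  have mem_iff: "((\<eta>, \<epsilon>), (\<eta>', \<epsilon>')) \<in> ?Adj
      \<longleftrightarrow> (\<eta>, \<epsilon>) \<in> ?Mnd \<and> \<eta>' = lift_unit \<eta> \<and> \<epsilon>' = lift_counit \<epsilon>" for \<eta> \<epsilon> \<eta>' \<epsilon>'
  proof
    assume "((\<eta>, \<epsilon>), (\<eta>', \<epsilon>')) \<in> ?Adj"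
    then show "(\<eta>, \<epsilon>) \<in> ?Mnd \<and> \<eta>' = lift_unit \<eta> \<and> \<epsilon>' = lift_counit \<epsilon>"
      unfolding families_iff hopf_param_adjunctions_AdjR.simps hopf_param_adjunctions_Mnd.simps
        cellA cellB EM_adj_sel
      by (auto simp only: mem_Collect_eq prod.case adjoint_object param_adjunctions_def)
  next
    assume rhs: "(\<eta>, \<epsilon>) \<in> ?Mnd \<and> \<eta>' = lift_unit \<eta> \<and> \<epsilon>' = lift_counit \<epsilon>"
    then have mnd: "mnd_1cell (S \<times>\<^sub>M id_mnd Q) T (A, \<psi>A)" "mnd_1cell (id_mnd (op_cat Q) \<times>\<^sub>M T) S (B, \<psi>B)"
        "(\<eta>, \<epsilon>) \<in> param_adjunctions (base S) Q (base T) A B"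
        "\<And>q. q \<in> Obj Q \<Longrightarrow> mnd_adjoint_object S T (fix_right Q A q, \<lambda>c. \<psi>A (c, q))
          (fix_left Q B q, \<lambda>d. \<psi>B (q, d)) (\<eta> q, \<epsilon> q)"
      and families: "\<eta>' \<in> component_families Q (EM S)" "\<epsilon>' \<in> component_families Q (EM T)"
      and \<eta>': "\<And>q x. q \<in> Obj Q \<Longrightarrow> x \<in> algebras S
        \<Longrightarrow> \<eta>' q x = (x, \<eta> q (fst x), omap (W q) (omap (V q) x))"
      and \<epsilon>': "\<And>q y. q \<in> Obj Q \<Longrightarrow> y \<in> algebras T
        \<Longrightarrow> \<epsilon>' q y = (omap (V q) (omap (W q) y), \<epsilon> q (fst y), y)"
      unfolding families_iff hopf_param_adjunctions_Mnd.simps by (simp_all only: mem_Collect_eq prod.case)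
    have objects: "adjR_adjoint_object (EM_adj S) (EM_adj T)
        (fix_right Q A q, fix_right Q ?V q, \<lambda>c. ?\<Lambda>A (c, q))
        (fix_left Q B q, fix_left Q ?W q, \<lambda>d. ?\<Lambda>B (q, d)) (\<eta> q, \<epsilon> q) (\<eta>' q, \<epsilon>' q)"
      if "q \<in> Obj Q" for q
      unfolding adjoint_object[OF that] using that mnd(4) \<eta>' \<epsilon>' by blast
    have cells: "adjR_1cell (EM_adj S \<times>\<^sub>A id_adj Q) (EM_adj T) (A, ?V, ?\<Lambda>A)"
      "adjR_1cell (id_adj (op_cat Q) \<times>\<^sub>A EM_adj T) (EM_adj S) (B, ?W, ?\<Lambda>B)"
      using mnd(1,2) unfolding cellA cellB by blast+
    \<comment> \<open>The adjoint objects give adjunctions at each parameter separately; the law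
      relating different parameters is still to be supplied.\<close>
    have "param_adjunction (EM S) Q (EM T) ?V ?W \<eta>' \<epsilon>'"
    proof (rule param_adjunction_lift)
      show "param_adjunction (base S) Q (base T) A B \<eta> \<epsilon>"
        using mnd(3) by (simp add: param_adjunctions_def)
      show "cat_functor (EM S \<times>\<^sub>C Q) (EM T) ?V" "cat_functor (op_cat Q \<times>\<^sub>C EM T) (EM S) ?W"
        using cells unfolding adjR_1cell.simps prod_adj_sel EM_adj_sel id_adj_sel by blast+
      show "adjunction (EM S) (EM T) (fix_right Q ?V q) (fix_left Q ?W q) (\<eta>' q) (\<epsilon>' q)"
        if "q \<in> Obj Q" for q
        using objects[OF that] unfolding adjR_adjoint_object.simps EM_adj_sel by blast
    qed (simp_all add: lift_ftr_right_def lift_ftr_left_def \<eta>' \<epsilon>')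
    then have "(\<eta>', \<epsilon>') \<in> param_adjunctions (EM S) Q (EM T) ?V ?W"
      using families by (simp only: param_adjunctions_def mem_Collect_eq prod.case)
    then show "((\<eta>, \<epsilon>), (\<eta>', \<epsilon>')) \<in> ?Adj"
      unfolding hopf_param_adjunctions_AdjR.simps EM_adj_sel mem_Collect_eq prod.case
      using cells mnd(3) objects by blast
  qed
  show ?thesis
  proof (rule bij_betw_byWitness[where f' = "\<lambda>(\<eta>, \<epsilon>). ((\<eta>, \<epsilon>), (lift_unit \<eta>, lift_counit \<epsilon>))"])
    show "\<forall>X \<in> ?Adj. (\<lambda>(\<eta>, \<epsilon>). ((\<eta>, \<epsilon>), (lift_unit \<eta>, lift_counit \<epsilon>))) (fst X) = X"
      and "fst ` ?Adj \<subseteq> ?Mnd"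
      using mem_iff by (auto simp only: split_paired_all fst_conv prod.case)
  qed (use mem_iff in \<open>auto simp only: split_paired_all fst_conv prod.case\<close>)
qed

theorem theorem5p2p2:
  fixes S :: "('co, 'ca) mnd" and E :: "('po, 'pa) mnd" and T :: "('do, 'da) mnd"
    and J :: "('co \<times> 'po, 'ca \<times> 'pa, 'do, 'da) ftr" and \<psi> :: "'co \<times> 'po \<Rightarrow> 'da"
    and K :: "('po \<times> 'do, 'pa \<times> 'da, 'co, 'ca) ftr"
    and \<eta> :: "'po \<Rightarrow> 'co \<Rightarrow> 'ca" and \<epsilon> :: "'po \<Rightarrow> 'do \<Rightarrow> 'da"
  assumes "is_monad S" and "is_monad E" and "is_monad T"
    and "mnd_1cell (S \<times>\<^sub>M E) T (J, \<psi>)"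
    and "left_hopf S E T (J, \<psi>)"
    and "param_adjunction (base S) (base E) (base T) J K \<eta> \<epsilon>"
  shows "\<exists>\<Phi>. bij_betw \<Phi>
    (hopf_param_adjunctions_AdjR (EM_adj S) (EM_adj T) (EM E)
      (restrict_right J,
       lift_ftr_right (EM E) T (restrict_right J, hopf_map S T (J, \<psi>)),
       lift_trans (S \<times>\<^sub>M id_mnd (EM E)) T (restrict_right J, hopf_map S T (J, \<psi>)))
      (restrict_left K,
       lift_ftr_left (op_cat (EM E)) S (restrict_left K, hopf_sharp S E T (J, \<psi>) K \<eta> \<epsilon>),
       lift_trans (id_mnd (op_cat (EM E)) \<times>\<^sub>M T) S
         (restrict_left K, hopf_sharp S E T (J, \<psi>) K \<eta> \<epsilon>)))
    (hopf_param_adjunctions_Mnd S T (EM E)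
      (restrict_right J, hopf_map S T (J, \<psi>))
      (restrict_left K, hopf_sharp S E T (J, \<psi>) K \<eta> \<epsilon>))"
proof -
  have "category (EM E)"
    using assms(2) by (simp add: is_monad_iff monad.category_EM)
  then show ?thesis
    \<comment> \<open>The witness is \<open>fst\<close>, with the algebras of \<open>E\<close> as
      parameter category.\<close>
    by (intro exI) (rule bij_betw_hopf_param_adjunctions[OF assms(1,3)])
qed

end
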